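(* The characteristic function of the anticyclic operad $\operatorname{Dias}$ is $$\mathbf{Ch}(\operatorname{Dias})=\sum_{n\ge2}\Big(p_1^n-\frac1n\sum_{d\mid n}\varphi(d)\,p_d^{n/d}\Big),$$ where $\varphi$ is the Euler totient function.
   Context: All vector spaces are over $\mathbb{Q}$. The symmetric group $\mathfrak{S}_n$ acts on $\mathcal{P}(n)$ by $(\sigma\cdot E)(x_1,\dots,x_n)=E(x_{\sigma(1)},\dots,x_{\sigma(n)})$. An anticyclic operad is a symmetric operad $\mathcal{P}$ (unit $1\in\mathcal{P}(1)$, partial compositions $\circ_i$) together with an action of $\mathfrak{S}_{n+1}$ on each $\mathcal{P}(n)$ extending the action of $\mathfrak{S}_n$ (the stabilizer of $n+1$), such that, writing $\tau_n$ for the action of the long cycle $(n+1,n,\dots,2,1)$ ($1\mapsto n+1$, $i\mapsto i-1$ for $i\ge 2$): $\tau_1(1)=-1$ and, for $f\in\mathcal{P}(m)$, $g\in\mathcal{P}(n)$, $\tau(f\circ_i g)=\tau_m(f)\circ_{i-1}g$ for $2\le i\le m$ and $\tau(f\circ_1 g)=-\tau_n(g)\circ_n\tau_m(f)$. A non-symmetric anticyclic operad is a non-symmetric operad with endomorphisms $\tau_n$ of $\mathcal{P}(n)$ satisfying $\tau_n^{n+1}=\mathrm{Id}$ and these same identities. If $\mathcal{P}$ is a non-symmetric anticyclic operad, the symmetric operad with components $\mathcal{P}(n)\otimes\mathbb{Q}\mathfrak{S}_n\cong\operatorname{Ind}_{\mathbb{Z}/(n+1)\mathbb{Z}}^{\mathfrak{S}_{n+1}}\mathcal{P}(n)$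 is naturally an anticyclic operad, with $\tau_n(E\otimes 1)=\tau_n(E)\otimes 1$ (here $\mathbb{Z}/(n+1)\mathbb{Z}$ is the subgroup of $\mathfrak{S}_{n+1}$ generated by $(n+1,n,\dots,2,1)$, acting through $\tau_n$). The characteristic function of an anticyclic operad $\mathcal{P}$ is $\mathbf{Ch}(\mathcal{P})=\sum_{n\ge1}\mathbf{Ch}_{n+1}(\mathcal{P}(n))$, where $\mathbf{Ch}_{n+1}(\mathcal{P}(n))$ is the symmetric function (Frobenius characteristic, homogeneous of degree $n+1$) of the $\mathfrak{S}_{n+1}$-module $\mathcal{P}(n)$, i.e. $\frac{1}{(n+1)!}\sum_{\sigma\in\mathfrak{S}_{n+1}}\operatorname{tr}(\sigma)\,p_{\text{cycle type of }\sigma}$. The $p_k$ are the power sum symmetric functions; identities hold in the completed ring of symmetric functions. The non-symmetric operad $\operatorname{Dias}$ is generated by binary operations $x\dashv y$, $x\vdash y$ with relations $x\dashv(y\vdash z)=x\dashv(y\dashv z)=(x\dashv y)\dashv z$, $x\vdash(y\dashv z)=(x\vdash y)\dashv z$, $x\vdash(y\vdash z)=(x\vdash y)\vdash z=(x\dashv y)\vdash z$. It is a non-symmetric anticyclic operad with the unique structure such that $\tau_1=-\mathrm{Id}$, $\tau_2(x_1\dashv x_2)=-x_1\vdash x_2$, $\tau_2(x_1\vdash x_2)=x_1\dashv x_2-x_1\vdash x_2$. In the claim, $\operatorname{Dias}$ denotes the associated (symmetric) anticyclic operad. *)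

theory Defs
  imports
    Complex_Main
    "HOL-Library.Multiset"
    "HOL-Library.Poly_Mapping"
    "HOL-Library.Tree"
    "HOL-Library.Function_Algebras"
    "HOL-Combinatorics.Permutations"
    "HOL-Combinatorics.Orbits"
    "HOL-Number_Theory.Totient"
begin

section \<open>Power series in countably many variables, and power sums\<close>

text \<open>
  A monomial in the variables \<open>x\<^sub>0, x\<^sub>1, \<dots>\<close> is a finite multiset of indices; its degree is the
  size of the multiset. The completed ring of symmetric functions over the rationals is the
  subring of those series that are invariant under permutations of the variables.
\<close>

typedef series = "UNIV :: (nat multiset \<Rightarrow> rat) set"
  morphisms coeff Series
  by simp

setup_lifting type_definition_series

lemma series_eqI: "(\<And>M. coeff F M = coeff G M) \<Longrightarrow> F = G"
  by transfer auto

lemma finite_splits: "finite {(A, B). A + B = (M :: 'a multiset)}"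
proof (induction M)
  case (add x M)
  have "{(A, B). A + B = add_mset x M} \<subseteq>
      (\<lambda>(A, B). (add_mset x A, B)) ` {(A, B). A + B = M} \<union>
      (\<lambda>(A, B). (A, add_mset x B)) ` {(A, B). A + B = M}"
  proof clarify
    fix A B
    assume AB: "A + B = add_mset x M"
      and nB: "(A, B) \<notin> (\<lambda>(A, B). (A, add_mset x B)) ` {(A, B). A + B = M}"
    have "x \<in># A + B" by (simp add: AB)
    then consider A' where "A = add_mset x A'" | B' where "B = add_mset x B'"
      by (metis mset_add union_iff)
    then show "(A, B) \<in> (\<lambda>(A, B). (add_mset x A, B)) ` {(A, B). A + B = M}"
    proof cases
      case 1
      then show ?thesis using AB by force
    next
      case 2
      then show ?thesis using AB nB by force
    qed
  qed
  then show ?case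
    using add.IH by (meson finite_UnI finite_imageI finite_subset)
qed simp

instantiation series :: comm_ring_1
begin

lift_definition zero_series :: series is "\<lambda>_. 0" .
lift_definition one_series :: series is "\<lambda>M. if M = {#} then 1 else 0" .
lift_definition plus_series :: "series \<Rightarrow> series \<Rightarrow> series" is "\<lambda>F G M. F M + G M" .
lift_definition minus_series :: "series \<Rightarrow> series \<Rightarrow> series" is "\<lambda>F G M. F M - G M" .
lift_definition uminus_series :: "series \<Rightarrow> series" is "\<lambda>F M. - F M" .
lift_definition times_series :: "series \<Rightarrow> series \<Rightarrow> series"
  is "\<lambda>F G M. \<Sum>(A, B)\<in>{(A, B). A + B = M}. F A * G B" .

instance
proof
  fix F G H :: series
  show "F * G * H = F * (G * H)"
  proof transfer
    fix F G H :: "nat multiset \<Rightarrow> rat"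
    have "(\<Sum>(A, C)\<in>{(A, C). A + C = M}.
             (\<Sum>(X, Y)\<in>{(X, Y). X + Y = A}. F X * G Y) * H C) =
          (\<Sum>(X, D)\<in>{(X, D). X + D = M}.
             F X * (\<Sum>(Y, C)\<in>{(Y, C). Y + C = D}. G Y * H C))" for M
    proof -
      let ?S = "\<lambda>M. {(A, B). A + B = (M :: nat multiset)}"
      have "(\<Sum>(A, C)\<in>?S M. (\<Sum>(X, Y)\<in>?S A. F X * G Y) * H C) =
          (\<Sum>p\<in>?S M. \<Sum>q\<in>?S (fst p). F (fst q) * G (snd q) * H (snd p))"
        by (simp add: sum_distrib_right case_prod_unfold)
      also have "\<dots> = (\<Sum>(p, q)\<in>(SIGMA p:?S M. ?S (fst p)). F (fst q) * G (snd q) * H (snd p))"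
        by (rule sum.Sigma) (auto simp: finite_splits)
      also have "\<dots> = (\<Sum>(p, q)\<in>(SIGMA p:?S M. ?S (snd p)). F (fst p) * (G (fst q) * H (snd q)))"
        by (rule sum.reindex_bij_witness
              [where i = "\<lambda>(p, q). ((fst p + fst q, snd q), (fst p, fst q))"
                and j = "\<lambda>(p, q). ((fst q, snd q + snd p), (snd q, snd p))"])
           (auto simp: add.assoc mult.assoc)
      also have "\<dots> = (\<Sum>p\<in>?S M. \<Sum>q\<in>?S (snd p). F (fst p) * (G (fst q) * H (snd q)))"
        by (rule sum.Sigma [symmetric]) (auto simp: finite_splits)
      also have "\<dots> = (\<Sum>(X, D)\<in>?S M. F X * (\<Sum>(Y, C)\<in>?S D. G Y * H C))"
        by (simp add: sum_distrib_left case_prod_unfold)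
      finally show ?thesis .
    qed
    then show "(\<lambda>M. \<Sum>(A, C)\<in>{(A, C). A + C = M}.
             (\<Sum>(X, Y)\<in>{(X, Y). X + Y = A}. F X * G Y) * H C) =
          (\<lambda>M. \<Sum>(X, D)\<in>{(X, D). X + D = M}.
             F X * (\<Sum>(Y, C)\<in>{(Y, C). Y + C = D}. G Y * H C))" by blast
  qed
  show "F * G = G * F"
    by transfer
      (auto intro!: sum.reindex_bij_witness[where i = prod.swap and j = prod.swap]
        simp: add.commute mult.commute)
  show "1 * F = F"
  proof transfer
    fix F :: "nat multiset \<Rightarrow> rat"
    have "(\<Sum>(A, B)\<in>{(A, B). A + B = M}. (if A = {#} then 1 else 0) * F B) = F M" for M
    proof -
      have "(\<Sum>(A, B)\<in>{(A, B). A + B = M}. (if A = {#} then 1 else 0) * F B) =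
          (\<Sum>(A, B)\<in>{({#} :: nat multiset, M)}. (if A = {#} then 1 else 0) * F B)"
        by (rule sum.mono_neutral_right) (auto simp: finite_splits split: if_splits)
      then show ?thesis by simp
    qed
    then show "(\<lambda>M. \<Sum>(A, B)\<in>{(A, B). A + B = M}. (if A = {#} then 1 else 0) * F B) = F"
      by blast
  qed
  show "(F + G) * H = F * H + G * H"
    by transfer (simp add: case_prod_unfold distrib_right sum.distrib)
  show "(0 :: series) \<noteq> 1"
    by transfer (metis zero_neq_one)
qed (transfer; simp add: algebra_simps)+

end

lift_definition const :: "rat \<Rightarrow> series" is "\<lambda>c M. if M = {#} then c else 0" .

text \<open>\<open>power_sum k\<close> is \<open>p\<^sub>k = x\<^sub>0\<^sup>k + x\<^sub>1\<^sup>k + \<dots>\<close> (for \<open>k \<ge> 1\<close>).\<close>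

lift_definition power_sum :: "nat \<Rightarrow> series"
  is "\<lambda>k M. if \<exists>i. M = replicate_mset k i then 1 else 0" .

text \<open>
  Coefficientwise infinite sum. It is meaningful when every monomial occurs in only finitely many
  summands, e.g. when the summands are homogeneous of pairwise different degrees, which is the only
  case in which it is used.
\<close>

definition formal_sum :: "nat set \<Rightarrow> (nat \<Rightarrow> series) \<Rightarrow> series" where
  "formal_sum S F = Series (\<lambda>M. \<Sum>n | n \<in> S \<and> coeff (F n) M \<noteq> 0. coeff (F n) M)"

section \<open>Frobenius characteristic\<close>

text \<open>
  Trace of an endomorphism \<open>f\<close> of the finite-dimensional subspace \<open>V\<close>, with respect to
  some basis of \<open>V\<close>; it does not depend on the basis.
\<close>

definition trace_on :: "(rat \<Rightarrow> 'a::ab_group_add \<Rightarrow> 'a) \<Rightarrow> 'a set \<Rightarrow> ('a \<Rightarrow> 'a) \<Rightarrow> rat" where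
  "trace_on scale V f =
     (let B = (SOME B. B \<subseteq> V \<and> \<not> module.dependent scale B \<and> module.span scale B = V)
      in \<Sum>b\<in>B. module.representation scale B (f b) b)"

definition cycle_type :: "nat \<Rightarrow> (nat \<Rightarrow> nat) \<Rightarrow> nat multiset" where
  "cycle_type N \<sigma> = image_mset card (mset_set (orbit \<sigma> ` {1..N}))"

definition frobenius_char ::
    "nat \<Rightarrow> (rat \<Rightarrow> 'a::ab_group_add \<Rightarrow> 'a) \<Rightarrow> 'a set \<Rightarrow> ((nat \<Rightarrow> nat) \<Rightarrow> 'a \<Rightarrow> 'a) \<Rightarrow> series" where
  "frobenius_char N scale V act =
     const (1 / fact N) *
     (\<Sum>\<sigma> | \<sigma> permutes {1..N}.
        const (trace_on scale V (act \<sigma>)) * (\<Prod>k\<in>#cycle_type N \<sigma>. power_sum k))"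

text \<open>
  The characteristic function of an anticyclic operad depends only on its components
  \<open>V n = \<P>(n)\<close> and the actions \<open>act n\<close> of the symmetric group on \<open>{1..n+1}\<close> on them; the
  compositions do not enter.
\<close>

definition char_function ::
    "(rat \<Rightarrow> 'a::ab_group_add \<Rightarrow> 'a) \<Rightarrow> (nat \<Rightarrow> 'a set) \<Rightarrow> (nat \<Rightarrow> (nat \<Rightarrow> nat) \<Rightarrow> 'a \<Rightarrow> 'a) \<Rightarrow> series" where
  "char_function scale V act =
     formal_sum {1..} (\<lambda>n. frobenius_char (n + 1) scale (V n) (act n))"

section \<open>Non-symmetric anticyclic operads\<close>

text \<open>
  The components \<open>P n\<close>, \<open>n \<ge> 1\<close>, are subspaces of one vector space, and \<open>comp f i g\<close> is the
  partial composition \<open>f \<circ>\<^sub>i g\<close>. Nothing is required of \<open>comp f i g\<close> for inhomogeneous \<open>f\<close>, \<open>g\<close>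
  or for \<open>i\<close> out of range.
\<close>

locale ns_operad = vector_space scale
  for scale :: "rat \<Rightarrow> 'a::ab_group_add \<Rightarrow> 'a" +
  fixes P :: "nat \<Rightarrow> 'a set"
    and comp :: "'a \<Rightarrow> nat \<Rightarrow> 'a \<Rightarrow> 'a"
    and unit :: 'a
  assumes subspace_P: "1 \<le> n \<Longrightarrow> subspace (P n)"
    and unit_in: "unit \<in> P 1"
    and comp_in: "\<lbrakk>f \<in> P m; g \<in> P n; 1 \<le> n; 1 \<le> i; i \<le> m\<rbrakk> \<Longrightarrow> comp f i g \<in> P (m + n - 1)"
    and comp_add_left: "\<lbrakk>f \<in> P m; f' \<in> P m; g \<in> P n; 1 \<le> n; 1 \<le> i; i \<le> m\<rbrakk>
          \<Longrightarrow> comp (f + f') i g = comp f i g + comp f' i g"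
    and comp_add_right: "\<lbrakk>f \<in> P m; g \<in> P n; g' \<in> P n; 1 \<le> n; 1 \<le> i; i \<le> m\<rbrakk>
          \<Longrightarrow> comp f i (g + g') = comp f i g + comp f i g'"
    and comp_scale_left: "\<lbrakk>f \<in> P m; g \<in> P n; 1 \<le> n; 1 \<le> i; i \<le> m\<rbrakk>
          \<Longrightarrow> comp (scale c f) i g = scale c (comp f i g)"
    and comp_scale_right: "\<lbrakk>f \<in> P m; g \<in> P n; 1 \<le> n; 1 \<le> i; i \<le> m\<rbrakk>
          \<Longrightarrow> comp f i (scale c g) = scale c (comp f i g)"
    and unit_comp: "\<lbrakk>g \<in> P n; 1 \<le> n\<rbrakk> \<Longrightarrow> comp unit 1 g = g"
    and comp_unit: "\<lbrakk>f \<in> P m; 1 \<le> i; i \<le> m\<rbrakk> \<Longrightarrow> comp f i unit = f"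
    and comp_sequential:
        "\<lbrakk>f \<in> P l; g \<in> P m; h \<in> P n; 1 \<le> n; 1 \<le> i; i \<le> l; 1 \<le> j; j \<le> m\<rbrakk>
          \<Longrightarrow> comp (comp f i g) (i + j - 1) h = comp f i (comp g j h)"
    and comp_parallel:
        "\<lbrakk>f \<in> P l; g \<in> P m; h \<in> P n; 1 \<le> m; 1 \<le> n; 1 \<le> i; i < k; k \<le> l\<rbrakk>
          \<Longrightarrow> comp (comp f i g) (k + m - 1) h = comp (comp f k h) i g"

locale ns_anticyclic_operad = ns_operad scale P comp unit
  for scale :: "rat \<Rightarrow> 'a::ab_group_add \<Rightarrow> 'a"
    and P :: "nat \<Rightarrow> 'a set"
    and comp :: "'a \<Rightarrow> nat \<Rightarrow> 'a \<Rightarrow> 'a"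
    and unit :: 'a +
  fixes \<tau> :: "nat \<Rightarrow> 'a \<Rightarrow> 'a"
  assumes tau_in: "\<lbrakk>f \<in> P n; 1 \<le> n\<rbrakk> \<Longrightarrow> \<tau> n f \<in> P n"
    and tau_add: "\<lbrakk>f \<in> P n; g \<in> P n; 1 \<le> n\<rbrakk> \<Longrightarrow> \<tau> n (f + g) = \<tau> n f + \<tau> n g"
    and tau_scale: "\<lbrakk>f \<in> P n; 1 \<le> n\<rbrakk> \<Longrightarrow> \<tau> n (scale c f) = scale c (\<tau> n f)"
    and tau_power: "\<lbrakk>f \<in> P n; 1 \<le> n\<rbrakk> \<Longrightarrow> (\<tau> n ^^ (n + 1)) f = f"
    and tau_unit: "\<tau> 1 unit = - unit"
    and tau_comp: "\<lbrakk>f \<in> P m; g \<in> P n; 1 \<le> n; 2 \<le> i; i \<le> m\<rbrakk>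
          \<Longrightarrow> \<tau> (m + n - 1) (comp f i g) = comp (\<tau> m f) (i - 1) g"
    and tau_comp_1: "\<lbrakk>f \<in> P m; g \<in> P n; 1 \<le> m; 1 \<le> n\<rbrakk>
          \<Longrightarrow> \<tau> (m + n - 1) (comp f 1 g) = - comp (\<tau> n g) n (\<tau> m f)"

section \<open>The modules of the associated symmetric anticyclic operad\<close>

text \<open>The cycle \<open>(N, N-1, \<dots>, 2, 1)\<close>, i.e. \<open>1 \<mapsto> N\<close> and \<open>i \<mapsto> i - 1\<close> for \<open>2 \<le> i \<le> N\<close>.\<close>

definition long_cycle :: "nat \<Rightarrow> nat \<Rightarrow> nat" where
  "long_cycle N i = (if i = 1 then N else if 2 \<le> i \<and> i \<le> N then i - 1 else i)"

text \<open>
  The representation of the symmetric group on \<open>{1..N}\<close> induced from the cyclic subgroup generated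
  by \<open>c = long_cycle N\<close>, acting on \<open>V\<close> through \<open>t\<close>: functions \<open>F\<close> from the group to \<open>V\<close> with
  \<open>F (\<pi> \<circ> c) = t\<^sup>-\<^sup>1 (F \<pi>)\<close>, with \<open>(\<sigma> \<cdot> F) \<pi> = F (\<sigma>\<^sup>-\<^sup>1 \<circ> \<pi>)\<close>. For \<open>N = n + 1\<close> the permutations
  fixing \<open>n + 1\<close> represent the cosets of the cyclic subgroup, so that this space is
  \<open>V \<otimes> \<rat>\<SS>\<^sub>n\<close>; the element \<open>E \<otimes> 1\<close> is the function supported on the cyclic subgroup with value \<open>E\<close>
  at the identity, and \<open>c\<close> sends it to \<open>t E \<otimes> 1\<close>.
\<close>

definition induced_space ::
    "nat \<Rightarrow> 'a set \<Rightarrow> ('a \<Rightarrow> 'a) \<Rightarrow> ((nat \<Rightarrow> nat) \<Rightarrow> 'a::ab_group_add) set" where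
  "induced_space N V t =
     {F. (\<forall>\<pi>. \<pi> permutes {1..N} \<longrightarrow> F \<pi> \<in> V \<and> t (F (\<pi> \<circ> long_cycle N)) = F \<pi>) \<and>
         (\<forall>\<pi>. \<not> \<pi> permutes {1..N} \<longrightarrow> F \<pi> = 0)}"

definition induced_action ::
    "(nat \<Rightarrow> nat) \<Rightarrow> ((nat \<Rightarrow> nat) \<Rightarrow> 'a) \<Rightarrow> ((nat \<Rightarrow> nat) \<Rightarrow> 'a)" where
  "induced_action \<sigma> F = (\<lambda>\<pi>. F (inv \<sigma> \<circ> \<pi>))"

definition induced_scale ::
    "(rat \<Rightarrow> 'a \<Rightarrow> 'a) \<Rightarrow> rat \<Rightarrow> ((nat \<Rightarrow> nat) \<Rightarrow> 'a) \<Rightarrow> ((nat \<Rightarrow> nat) \<Rightarrow> 'a)" where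
  "induced_scale scale c F = (\<lambda>\<pi>. scale c (F \<pi>))"

text \<open>Characteristic function of the symmetric anticyclic operad associated with the non-symmetric
  anticyclic operad with components \<open>P n\<close> and rotations \<open>\<tau> n\<close>.\<close>

definition char_function_ns ::
    "(rat \<Rightarrow> 'a::ab_group_add \<Rightarrow> 'a) \<Rightarrow> (nat \<Rightarrow> 'a set) \<Rightarrow> (nat \<Rightarrow> 'a \<Rightarrow> 'a) \<Rightarrow> series" where
  "char_function_ns scale P \<tau> =
     char_function (induced_scale scale)
       (\<lambda>n. induced_space (n + 1) (P n) (\<tau> n)) (\<lambda>n. induced_action)"

section \<open>The operad Dias\<close>

text \<open>
  The free non-symmetric operad on a set of binary generators: linear combinations of planar binary
  trees with nodes labelled by generators. The arity of a tree is its number \<open>size1\<close> of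
  leaves, and \<open>graft s i t\<close> grafts \<open>t\<close> onto the \<open>i\<close>-th leaf of \<open>s\<close>, for \<open>1 \<le> i \<le> size1 s\<close>.
\<close>

fun graft :: "'g tree \<Rightarrow> nat \<Rightarrow> 'g tree \<Rightarrow> 'g tree" where
  "graft \<langle>\<rangle> i t = t"
| "graft \<langle>l, x, r\<rangle> i t =
     (if i \<le> size1 l then \<langle>graft l i t, x, r\<rangle> else \<langle>l, x, graft r (i - size1 l) t\<rangle>)"

abbreviation free_scale :: "rat \<Rightarrow> ('g tree \<Rightarrow>\<^sub>0 rat) \<Rightarrow> 'g tree \<Rightarrow>\<^sub>0 rat" where
  "free_scale c \<equiv> Poly_Mapping.map ((*) c)"

text \<open>On inhomogeneous elements, trees with fewer than \<open>i\<close> leaves contribute \<open>0\<close>.\<close>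

definition free_comp :: "('g tree \<Rightarrow>\<^sub>0 rat) \<Rightarrow> nat \<Rightarrow> ('g tree \<Rightarrow>\<^sub>0 rat) \<Rightarrow> 'g tree \<Rightarrow>\<^sub>0 rat" where
  "free_comp f i g =
     (\<Sum>s\<in>Poly_Mapping.keys f. \<Sum>t\<in>Poly_Mapping.keys g.
        if 1 \<le> i \<and> i \<le> size1 s
        then Poly_Mapping.single (graft s i t) (Poly_Mapping.lookup f s * Poly_Mapping.lookup g t)
        else 0)"

datatype dias_gen = Dashv | Vdash

abbreviation dashv_tree :: "dias_gen tree \<Rightarrow> dias_gen tree \<Rightarrow> dias_gen tree"
    (infixl \<open>\<stileturn>\<close> 65) where
  "s \<stileturn> t \<equiv> \<langle>s, Dashv, t\<rangle>"

abbreviation vdash_tree :: "dias_gen tree \<Rightarrow> dias_gen tree \<Rightarrow> dias_gen tree"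
    (infixl \<open>\<turnstile>\<close> 65) where
  "s \<turnstile> t \<equiv> \<langle>s, Vdash, t\<rangle>"

definition dias_relations :: "(dias_gen tree \<times> dias_gen tree) set" where
  "dias_relations = (let x = \<langle>\<rangle>; y = \<langle>\<rangle>; z = \<langle>\<rangle> in
     {(x \<stileturn> (y \<turnstile> z), x \<stileturn> (y \<stileturn> z)),
      (x \<stileturn> (y \<stileturn> z), (x \<stileturn> y) \<stileturn> z),
      (x \<turnstile> (y \<stileturn> z), (x \<turnstile> y) \<stileturn> z),
      (x \<turnstile> (y \<turnstile> z), (x \<turnstile> y) \<turnstile> z),
      ((x \<turnstile> y) \<turnstile> z, (x \<stileturn> y) \<turnstile> z)})"

text \<open>The operadic ideal generated by the relations, as a subspace of the direct sum of all
  components of the free operad.\<close>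

inductive_set dias_ideal :: "(dias_gen tree \<Rightarrow>\<^sub>0 rat) set" where
  relation: "(s, t) \<in> dias_relations
    \<Longrightarrow> Poly_Mapping.single s 1 - Poly_Mapping.single t 1 \<in> dias_ideal"
| zero: "0 \<in> dias_ideal"
| add: "f \<in> dias_ideal \<Longrightarrow> g \<in> dias_ideal \<Longrightarrow> f + g \<in> dias_ideal"
| scale: "f \<in> dias_ideal \<Longrightarrow> free_scale c f \<in> dias_ideal"
| comp_left: "f \<in> dias_ideal \<Longrightarrow> free_comp f i g \<in> dias_ideal"
| comp_right: "g \<in> dias_ideal \<Longrightarrow> free_comp f i g \<in> dias_ideal"

lemma free_scale_lookup:
  "Poly_Mapping.lookup (free_scale c f) t = c * Poly_Mapping.lookup f t"
  by (simp add: Poly_Mapping.map.rep_eq when_def)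

lemma free_scale_minus_one: "free_scale (- 1) f = - f"
  by (rule poly_mapping_eqI) (simp add: free_scale_lookup)

lemma free_scale_diff: "free_scale c f - free_scale c g = free_scale c (f - g)"
  by (rule poly_mapping_eqI) (simp add: free_scale_lookup lookup_minus algebra_simps)

lemma dias_ideal_uminus: "f \<in> dias_ideal \<Longrightarrow> - f \<in> dias_ideal"
  using dias_ideal.scale[of f "- 1"] by (simp add: free_scale_minus_one)

lemma free_comp_superset:
  assumes "finite A" "Poly_Mapping.keys f \<subseteq> A" "finite B" "Poly_Mapping.keys g \<subseteq> B"
  shows "free_comp f i g =
     (\<Sum>s\<in>A. \<Sum>t\<in>B. if 1 \<le> i \<and> i \<le> size1 s
        then Poly_Mapping.single (graft s i t) (Poly_Mapping.lookup f s * Poly_Mapping.lookup g t)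
        else 0)"
proof -
  have "free_comp f i g = (\<Sum>s\<in>Poly_Mapping.keys f. \<Sum>t\<in>B. if 1 \<le> i \<and> i \<le> size1 s
        then Poly_Mapping.single (graft s i t) (Poly_Mapping.lookup f s * Poly_Mapping.lookup g t)
        else 0)"
    unfolding free_comp_def using assms
    by (intro sum.cong refl sum.mono_neutral_left) (auto simp: in_keys_iff)
  also have "\<dots> = (\<Sum>s\<in>A. \<Sum>t\<in>B. if 1 \<le> i \<and> i \<le> size1 s
        then Poly_Mapping.single (graft s i t) (Poly_Mapping.lookup f s * Poly_Mapping.lookup g t)
        else 0)"
    using assms
    by (intro sum.mono_neutral_left ballI sum.neutral) (auto simp: in_keys_iff)
  finally show ?thesis .
qed

lemma free_comp_diff_left: "free_comp (f - f') i g = free_comp f i g - free_comp f' i g"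
proof -
  let ?A = "Poly_Mapping.keys f \<union> Poly_Mapping.keys f'"
  note * = free_comp_superset[where A = ?A and B = "Poly_Mapping.keys g" and g = g]
  show ?thesis
    using keys_diff[of f f']
    by (simp add: * sum_subtractf [symmetric] lookup_minus left_diff_distrib single_diff
          if_distrib cong: if_cong)
qed

lemma free_comp_diff_right: "free_comp f i (g - g') = free_comp f i g - free_comp f i g'"
proof -
  let ?B = "Poly_Mapping.keys g \<union> Poly_Mapping.keys g'"
  note * = free_comp_superset[where A = "Poly_Mapping.keys f" and B = ?B and f = f]
  show ?thesis
    using keys_diff[of g g']
    by (simp add: * sum_subtractf [symmetric] lookup_minus right_diff_distrib single_diff
          if_distrib cong: if_cong)
qed

text \<open>The direct sum of all components of Dias.\<close>

quotient_type dias = "dias_gen tree \<Rightarrow>\<^sub>0 rat" / "\<lambda>f g. f - g \<in> dias_ideal"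
  morphisms rep_dias dias_class
proof (rule equivpI)
  show "reflp (\<lambda>f g. f - g \<in> dias_ideal)"
    by (simp add: reflp_def dias_ideal.zero)
  show "symp (\<lambda>f g. f - g \<in> dias_ideal)"
    by (rule sympI) (drule dias_ideal_uminus, simp)
  show "transp (\<lambda>f g. f - g \<in> dias_ideal)"
    by (rule transpI) (drule (1) dias_ideal.add, simp)
qed

instantiation dias :: ab_group_add
begin

lift_definition zero_dias :: dias is 0 .
lift_definition plus_dias :: "dias \<Rightarrow> dias \<Rightarrow> dias" is "(+)"
  by (drule (1) dias_ideal.add) (simp add: algebra_simps)
lift_definition uminus_dias :: "dias \<Rightarrow> dias" is uminus
  by (drule dias_ideal_uminus) (simp add: algebra_simps)
lift_definition minus_dias :: "dias \<Rightarrow> dias \<Rightarrow> dias" is "(-)"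
proof -
  fix f f' g g' :: "dias_gen tree \<Rightarrow>\<^sub>0 rat"
  assume "f - f' \<in> dias_ideal" "g - g' \<in> dias_ideal"
  then have "(f - f') + - (g - g') \<in> dias_ideal"
    by (intro dias_ideal.add dias_ideal_uminus)
  then show "f - g - (f' - g') \<in> dias_ideal"
    by (simp add: algebra_simps)
qed

instance
  by standard (transfer; simp add: algebra_simps dias_ideal.zero)+

end

lift_definition dias_scale :: "rat \<Rightarrow> dias \<Rightarrow> dias" is free_scale
  by (simp add: free_scale_diff dias_ideal.scale)

lift_definition dias_comp :: "dias \<Rightarrow> nat \<Rightarrow> dias \<Rightarrow> dias" is free_comp
proof -
  fix f f' g g' :: "dias_gen tree \<Rightarrow>\<^sub>0 rat" and i
  assume "f - f' \<in> dias_ideal" "g - g' \<in> dias_ideal"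
  then have "free_comp (f - f') i g + free_comp f' i (g - g') \<in> dias_ideal"
    by (intro dias_ideal.add dias_ideal.comp_left dias_ideal.comp_right)
  then show "free_comp f i g - free_comp f' i g' \<in> dias_ideal"
    by (simp add: free_comp_diff_left free_comp_diff_right)
qed

definition Dias :: "nat \<Rightarrow> dias set" where
  "Dias n = dias_class ` {f. \<forall>t\<in>Poly_Mapping.keys f. size1 t = n}"

definition dias_unit :: dias where
  "dias_unit = dias_class (Poly_Mapping.single \<langle>\<rangle> 1)"

definition dias_dashv :: dias where
  "dias_dashv = dias_class (Poly_Mapping.single (\<langle>\<rangle> \<stileturn> \<langle>\<rangle>) 1)"

definition dias_vdash :: dias where
  "dias_vdash = dias_class (Poly_Mapping.single (\<langle>\<rangle> \<turnstile> \<langle>\<rangle>) 1)"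

lemma vector_space_dias: "vector_space dias_scale"
proof
  fix a b :: rat and x y :: dias
  have eq: "f - g \<in> dias_ideal" if "f = g" for f g :: "dias_gen tree \<Rightarrow>\<^sub>0 rat"
    using that by (simp add: dias_ideal.zero)
  show "dias_scale a (x + y) = dias_scale a x + dias_scale a y"
    by transfer
      (rule eq, rule poly_mapping_eqI, simp add: free_scale_lookup lookup_add algebra_simps)
  show "dias_scale (a + b) x = dias_scale a x + dias_scale b x"
    by transfer
      (rule eq, rule poly_mapping_eqI, simp add: free_scale_lookup lookup_add algebra_simps)
  show "dias_scale a (dias_scale b x) = dias_scale (a * b) x"
    by transfer (rule eq, rule poly_mapping_eqI, simp add: free_scale_lookup)
  show "dias_scale 1 x = x"
    by transfer (rule eq, rule poly_mapping_eqI, simp add: free_scale_lookup)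
qed

text \<open>
  The anticyclic structure of Dias. Its values on the components are uniquely determined;
  \<open>SOME\<close> rather than \<open>THE\<close> is used because \<open>dias_tau n\<close> is not constrained outside \<open>Dias n\<close>.
\<close>

definition dias_tau :: "nat \<Rightarrow> dias \<Rightarrow> dias" where
  "dias_tau = (SOME \<tau>.
     ns_anticyclic_operad dias_scale Dias dias_comp dias_unit \<tau> \<and>
     (\<forall>f\<in>Dias 1. \<tau> 1 f = - f) \<and>
     \<tau> 2 dias_dashv = - dias_vdash \<and>
     \<tau> 2 dias_vdash = dias_dashv - dias_vdash)"

end

theory Submission
  imports Defs "HOL-Combinatorics.Cycles"
begin

text \<open>
  The component \<open>Dias n\<close> has a basis \<open>e\<^sub>1, \<dots>, e\<^sub>n\<close>: modulo the relations, a tree remembers only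
  its number of leaves and one distinguished leaf, the one reached from the root by going left at
  \<open>\<stileturn>\<close> and right at \<open>\<turnstile>\<close>, and \<open>e\<^sub>i\<close> is the class of the trees with \<open>n\<close> leaves that point at the
  \<open>i\<close>-th one. That the relations identify trees with the same data is a rewriting argument
  (\<open>tree_class_comb\<close>); that they identify no more follows because any linear functional depending
  only on these data vanishes on the ideal (\<open>pointer_eval_ideal\<close>). Composition becomes a piecewise
  formula on indices (\<open>dias_comp_basis\<close>), and checking identities in Dias is arithmetic.

  On this basis the rotation is \<open>\<tau> e\<^sub>i = e\<^sub>i\<^sub>-\<^sub>1 - e\<^sub>n\<close> with \<open>e\<^sub>0 = 0\<close>. These maps satisfy the axioms
  (\<open>is_dias_rotation_rotate_dias\<close>), and they are the only ones, because \<open>\<tau>\<close> of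
  \<open>x \<circ>\<^sub>1 y\<close> is determined by \<open>\<tau> x\<close> and \<open>\<tau> y\<close>, and every basis vector of higher arity is
  such a composition of a generator with a basis vector
  (\<open>dias_rotation_unique\<close>). Reading the indices modulo \<open>n + 1\<close>, the vectors \<open>e\<^sub>0, \<dots>, e\<^sub>n\<close> are the
  differences \<open>v\<^sub>i - v\<^sub>0\<close> of \<open>n + 1\<close> cyclically permuted vectors \<open>v\<^sub>i\<close>: as a module of the cyclic group of
  order \<open>n + 1\<close>, \<open>Dias n\<close> is the regular representation minus the trivial one. Hence
  \<open>\<tau>\<^sup>k\<close> has trace \<open>n\<close> for \<open>k = 0\<close> and \<open>-1\<close> for \<open>0 < k \<le> n\<close> (\<open>trace_dias_tau_power\<close>).

  The Frobenius characteristic of a module induced from the group generated by the long cycle \<open>c\<close>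
  of length \<open>N\<close> is \<open>1/N\<close> times the sum over \<open>k < N\<close> of the trace of the \<open>k\<close>-th power times
  the power sum product of the cycle type of \<open>c\<^sup>k\<close> (\<open>frobenius_char_induced\<close>). Since \<open>c\<^sup>k\<close> consists of
  \<open>g = gcd k N\<close> cycles of length \<open>N/g\<close>, collecting the \<open>k\<close> with the same \<open>g\<close> turns the trivial
  representation into the sum over the divisors of \<open>N\<close> with totients, and the regular one into
  \<open>p\<^sub>1\<^sup>N\<close>.
\<close>

section \<open>Traces\<close>

text \<open>Linearity on a subspace: the rotations of an anticyclic operad are specified only on its
  components and need not be linear on the whole ambient type.\<close>

definition linear_on ::
    "(rat \<Rightarrow> 'a::ab_group_add \<Rightarrow> 'a) \<Rightarrow> (rat \<Rightarrow> 'b::ab_group_add \<Rightarrow> 'b) \<Rightarrow> 'a set \<Rightarrow> ('a \<Rightarrow> 'b) \<Rightarrow> bool" where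
  "linear_on s s' V f \<longleftrightarrow>
     (\<forall>x\<in>V. \<forall>y\<in>V. f (x + y) = f x + f y) \<and> (\<forall>c. \<forall>x\<in>V. f (s c x) = s' c (f x))"

lemma vector_space_rat: "vector_space ((*) :: rat \<Rightarrow> rat \<Rightarrow> rat)"
  by unfold_locales (simp_all add: algebra_simps)

lemma linear_on_0:
  assumes "vector_space s" "vector_space s'" "linear_on s s' V f" "0 \<in> V"
  shows "f 0 = 0"
proof -
  interpret S: vector_space s by fact
  interpret S': vector_space s' by fact
  have "f (s 0 0) = s' 0 (f 0)"
    using assms(3,4) by (auto simp: linear_on_def simp del: S.scale_zero_left S.scale_zero_right)
  then show ?thesis by simp
qed

lemma linear_on_sum_scale:
  assumes s: "vector_space s" and s': "vector_space s'" and f: "linear_on s s' V f"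
    and V: "module.subspace s V" and x: "\<And>i. i \<in> I \<Longrightarrow> x i \<in> V"
  shows "f (\<Sum>i\<in>I. s (c i) (x i)) = (\<Sum>i\<in>I. s' (c i) (f (x i)))"
proof -
  interpret S: vector_space s by fact
  interpret S': vector_space s' by fact
  show ?thesis
    using x
  proof (induction I rule: infinite_finite_induct)
    case (insert i I)
    have "s (c i) (x i) \<in> V" "(\<Sum>i\<in>I. s (c i) (x i)) \<in> V"
      using insert.prems V by (auto intro!: S.subspace_sum S.subspace_scale)
    then show ?case
      using insert f by (auto simp: linear_on_def)
  qed (use linear_on_0[OF s s' f] V S.subspace_0 in auto)
qed

lemma linear_on_funpow:
  assumes "linear_on s s V f" "f ` V \<subseteq> V"
  shows "linear_on s s V (f ^^ k)" and "(f ^^ k) ` V \<subseteq> V"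
proof -
  have "linear_on s s V (f ^^ k) \<and> (f ^^ k) ` V \<subseteq> V"
    by (induction k) (use assms in \<open>auto simp: linear_on_def image_subset_iff\<close>)
  then show "linear_on s s V (f ^^ k)" "(f ^^ k) ` V \<subseteq> V" by auto
qed

text \<open>The trace may be computed from any finite family of vectors \<open>v i\<close> in \<open>V\<close> with coefficient functionals \<open>\<phi> i\<close>
  that reconstruct every vector, even when the \<open>v i\<close> are linearly dependent: \<open>f\<close> then is the sum of
  the rank-one maps \<open>\<phi> i \<otimes> f (v i)\<close>, and the trace of such a map is \<open>\<phi> i (f (v i))\<close>. This gives
  independence of the basis chosen in \<open>trace_on\<close>, and it makes an explicit basis of an induced module
  (which would need coset representatives) unnecessary.\<close>

theorem trace_on_frame:
  assumes s: "vector_space s" and V: "module.subspace s V"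
    and I: "finite I" and v: "\<And>i. i \<in> I \<Longrightarrow> v i \<in> V"
    and \<phi>: "\<And>i. i \<in> I \<Longrightarrow> linear_on s (*) V (\<phi> i)"
    and expand: "\<And>x. x \<in> V \<Longrightarrow> (\<Sum>i\<in>I. s (\<phi> i x) (v i)) = x"
    and f: "linear_on s s V f" "f ` V \<subseteq> V"
  shows "trace_on s V f = (\<Sum>i\<in>I. \<phi> i (f (v i)))"
proof -
  interpret vector_space s by fact
  define B where "B = (SOME B. B \<subseteq> V \<and> independent B \<and> span B = V)"
  have "\<exists>B. B \<subseteq> V \<and> independent B \<and> span B = V"
    using basis_exists[of V] V by (metis span_minimal subset_antisym)
  then have "B \<subseteq> V \<and> independent B \<and> span B = V"
    unfolding B_def by (rule someI_ex)
  then have B: "B \<subseteq> V" "independent B" "span B = V" by auto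
  have "V \<subseteq> span (v ` I)"
  proof
    fix x assume "x \<in> V"
    then have "x = (\<Sum>i\<in>I. s (\<phi> i x) (v i))" by (simp add: expand)
    also have "\<dots> \<in> span (v ` I)" by (intro span_sum span_scale span_base) auto
    finally show "x \<in> span (v ` I)" .
  qed
  then have finB: "finite B"
    using independent_span_bound[of "v ` I" B] B I by auto
  have "trace_on s V f = (\<Sum>b\<in>B. representation B (f b) b)"
    by (simp add: trace_on_def B_def Let_def)
  also have "\<dots> = (\<Sum>b\<in>B. \<Sum>i\<in>I. \<phi> i b * representation B (f (v i)) b)"
  proof (rule sum.cong)
    fix b assume b: "b \<in> B"
    have "f b = f (\<Sum>i\<in>I. s (\<phi> i b) (v i))"
      using b B by (simp add: expand subset_iff)
    also have "\<dots> = (\<Sum>i\<in>I. s (\<phi> i b) (f (v i)))"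
      by (rule linear_on_sum_scale[OF s s f(1) V v])
    finally have fb: "f b = (\<Sum>i\<in>I. s (\<phi> i b) (f (v i)))" .
    have "f (v i) \<in> span B" if "i \<in> I" for i
      using that v f B by auto
    then show "representation B (f b) b = (\<Sum>i\<in>I. \<phi> i b * representation B (f (v i)) b)"
      unfolding fb using B by (subst representation_sum) (auto simp: representation_scale intro!: subspace_scale V)
  qed simp
  also have "\<dots> = (\<Sum>i\<in>I. \<Sum>b\<in>B. representation B (f (v i)) b * \<phi> i b)"
    by (subst sum.swap) (simp add: mult.commute)
  also have "\<dots> = (\<Sum>i\<in>I. \<phi> i (f (v i)))"
  proof (rule sum.cong)
    fix i assume i: "i \<in> I"
    have "f (v i) \<in> span B" using i v f B by auto
    then have "f (v i) = (\<Sum>b\<in>B. s (representation B (f (v i)) b) b)"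
      using sum_representation_eq[OF B(2) _ finB order_refl] by simp
    moreover have "\<phi> i (\<Sum>b\<in>B. s (representation B (f (v i)) b) b) =
        (\<Sum>b\<in>B. representation B (f (v i)) b * \<phi> i b)"
      by (rule linear_on_sum_scale[OF s vector_space_rat \<phi>[OF i] V]) (use B in auto)
    ultimately show "(\<Sum>b\<in>B. representation B (f (v i)) b * \<phi> i b) = \<phi> i (f (v i))"
      by simp
  qed simp
  finally show ?thesis .
qed

section \<open>Cycle types of the powers of the long cycle\<close>

lemma long_cycle_in: "i \<in> {1..N} \<Longrightarrow> long_cycle N i \<in> {1..N}"
  by (auto simp: long_cycle_def)

text \<open>Modulo \<open>N\<close> the long cycle is subtraction of 1. All facts about its powers are read off from
  this.\<close>

lemma long_cycle_cong: "i \<in> {1..N} \<Longrightarrow> [int (long_cycle N i) = int i - 1] (mod int N)"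
  by (auto simp: long_cycle_def cong_iff_dvd_diff of_nat_diff)

lemma long_cycle_funpow:
  assumes "i \<in> {1..N}"
  shows "(long_cycle N ^^ k) i \<in> {1..N}"
    and "[int ((long_cycle N ^^ k) i) = int i - int k] (mod int N)"
proof -
  have "(long_cycle N ^^ k) i \<in> {1..N} \<and> [int ((long_cycle N ^^ k) i) = int i - int k] (mod int N)"
  proof (induction k)
    case (Suc k)
    have "[int ((long_cycle N ^^ k) i) - 1 = int i - int k - 1] (mod int N)"
      using Suc by (intro cong_diff) auto
    with Suc long_cycle_cong[of "(long_cycle N ^^ k) i" N] long_cycle_in[of "(long_cycle N ^^ k) i" N]
    show ?case by (auto intro: cong_trans simp: algebra_simps)
  qed (use assms in auto)
  then show "(long_cycle N ^^ k) i \<in> {1..N}"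
    "[int ((long_cycle N ^^ k) i) = int i - int k] (mod int N)" by auto
qed

lemma eq_if_cong_in_range:
  assumes "[int i = int j] (mod int N)" "i \<in> {1..N}" "j \<in> {1..N}"
  shows "i = j"
proof -
  have "int N dvd int i - int j" using assms(1) by (simp add: cong_iff_dvd_diff)
  moreover have "\<bar>int i - int j\<bar> < int N" using assms by auto
  ultimately have "int i - int j = 0" by (metis dvd_imp_le_int linorder_not_less abs_of_nat)
  then show ?thesis by simp
qed

lemma long_cycle_funpow_eq_iff:
  assumes "i \<in> {1..N}"
  shows "(long_cycle N ^^ k) i = (long_cycle N ^^ l) i \<longleftrightarrow> [int k = int l] (mod int N)"
proof -
  note * = long_cycle_funpow[OF assms]
  have "(long_cycle N ^^ k) i = (long_cycle N ^^ l) i \<longleftrightarrow>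
      [int ((long_cycle N ^^ k) i) = int ((long_cycle N ^^ l) i)] (mod int N)"
    using eq_if_cong_in_range *(1) by auto
  also have "\<dots> \<longleftrightarrow> [int i - int k = int i - int l] (mod int N)"
    using *(2) by (meson cong_sym cong_trans)
  also have "\<dots> \<longleftrightarrow> [int k = int l] (mod int N)"
    using cong_diff_iff_cong_0 by (simp add: cong_iff_dvd_diff dvd_diff_commute)
  finally show ?thesis .
qed

lemma long_cycle_funpow_self:
  assumes "N > 0"
  shows "long_cycle N ^^ N = id"
proof
  fix i
  have "(long_cycle N ^^ k) i = i" if "i \<notin> {1..N}" for k
    using that assms by (induction k) (auto simp: long_cycle_def)
  moreover have "(long_cycle N ^^ N) i = i" if "i \<in> {1..N}"
    using long_cycle_funpow_eq_iff[OF that, of N 0] by (simp add: cong_iff_dvd_diff)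
  ultimately show "(long_cycle N ^^ N) i = id i" by (cases "i \<in> {1..N}") auto
qed

lemma long_cycle_permutes:
  assumes "N > 0"
  shows "long_cycle N permutes {1..N}"
proof (rule bij_imp_permutes)
  have "inj_on (long_cycle N) {1..N}"
    by (auto simp: inj_on_def long_cycle_def split: if_splits)
  moreover have "long_cycle N ` {1..N} \<subseteq> {1..N}" using long_cycle_in by blast
  ultimately show "bij_betw (long_cycle N) {1..N} {1..N}"
    by (simp add: bij_betw_def endo_inj_surj)
qed (use assms in \<open>auto simp: long_cycle_def\<close>)

lemma long_cycle_funpow_permutes: "N > 0 \<Longrightarrow> (long_cycle N ^^ k) permutes {1..N}"
  by (rule permutes_funpow[OF long_cycle_permutes])

lemma cycle_type_uniform:
  assumes \<sigma>: "\<sigma> permutes {1..N}" and d: "\<And>x. x \<in> {1..N} \<Longrightarrow> card (orbit \<sigma> x) = d" and "d > 0"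
  shows "cycle_type N \<sigma> = replicate_mset (N div d) d"
proof -
  have perm: "permutation \<sigma>" using \<sigma> permutation_permutes by blast
  have sub: "orbit \<sigma> x \<subseteq> {1..N}" if "x \<in> {1..N}" for x
    using permutes_orbit_subset[OF \<sigma> that] .
  have Un: "\<Union> (orbit \<sigma> ` {1..N}) = {1..N}"
    using sub permutation_self_in_orbit[OF perm] by blast
  have "d * card (orbit \<sigma> ` {1..N}) = card (\<Union> (orbit \<sigma> ` {1..N}))"
  proof (rule card_partition)
    show "finite (\<Union> (orbit \<sigma> ` {1..N}))" unfolding Un by simp
  next
    fix a b assume "a \<in> orbit \<sigma> ` {1..N}" "b \<in> orbit \<sigma> ` {1..N}" "a \<noteq> b"
    then obtain x y where xy: "a = orbit \<sigma> x" "b = orbit \<sigma> y" by auto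
    have "orbit \<sigma> x = orbit \<sigma> y" if "z \<in> orbit \<sigma> x" "z \<in> orbit \<sigma> y" for z
      using that perm
      by (metis cyclic_on_orbit' orbit_cyclic_eq3)
    then show "a \<inter> b = {}" using xy \<open>a \<noteq> b\<close> by auto
  qed (use d in auto)
  then have "card (orbit \<sigma> ` {1..N}) = N div d"
    unfolding Un using \<open>d > 0\<close> by (metis card_atLeastAtMost add_diff_cancel_right'
        Suc_eq_plus1 nonzero_mult_div_cancel_left not_gr_zero)
  moreover have "cycle_type N \<sigma> = image_mset (\<lambda>_. d) (mset_set (orbit \<sigma> ` {1..N}))"
    unfolding cycle_type_def by (rule image_mset_cong) (auto simp: d)
  ultimately show ?thesis by (simp add: image_mset_const_eq)
qed

text \<open>This determines when two powers of \<open>c\<^sup>k\<close> agree at a point, hence the length of its cycles.\<close>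

lemma cong_mult_cancel_gcd:
  assumes "(N::nat) > 0"
  shows "[k * a = k * b] (mod N) \<longleftrightarrow> [a = b] (mod N div gcd k N)"
proof -
  define g where "g = gcd k N"
  have "g > 0" using assms by (simp add: g_def)
  obtain k' d where kd: "k = k' * g" "N = d * g" "coprime k' d"
    using gcd_coprime_exists[of k N] \<open>g > 0\<close> unfolding g_def by blast
  have "[k * a = k * b] (mod N) \<longleftrightarrow> [int (k' * g * a) = int (k' * g * b)] (mod int (d * g))"
    unfolding cong_int_iff kd by simp
  also have "\<dots> \<longleftrightarrow> int (d * g) dvd int g * (int k' * (int a - int b))"
    unfolding cong_iff_dvd_diff by (simp add: algebra_simps)
  also have "\<dots> \<longleftrightarrow> int d dvd int k' * (int a - int b)"
    using \<open>g > 0\<close> by (simp add: mult.commute)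
  also have "\<dots> \<longleftrightarrow> int d dvd int a - int b"
    using kd(3) by (simp add: coprime_dvd_mult_right_iff coprime_commute)
  also have "d = N div gcd k N" using \<open>g > 0\<close> kd(2) g_def by (metis nonzero_mult_div_cancel_right less_numeral_extra(3))
  finally show ?thesis
    unfolding cong_int_iff[symmetric] cong_iff_dvd_diff .
qed

lemma card_orbit_long_cycle_funpow:
  assumes x: "x \<in> {1..N}"
  shows "card (orbit (long_cycle N ^^ k) x) = N div gcd k N"
proof -
  let ?d = "N div gcd k N"
  have "N > 0" using x by auto
  then have "?d > 0" by (simp add: div_greater_zero_iff)
  have iff: "((long_cycle N ^^ k) ^^ a) x = ((long_cycle N ^^ k) ^^ b) x \<longleftrightarrow> [a = b] (mod ?d)" for a b
  proof -
    have "((long_cycle N ^^ k) ^^ a) x = ((long_cycle N ^^ k) ^^ b) x \<longleftrightarrow> [k * a = k * b] (mod N)"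
      by (simp add: funpow_mult long_cycle_funpow_eq_iff[OF x] mult.commute
          flip: cong_int_iff)
    also have "\<dots> \<longleftrightarrow> [a = b] (mod ?d)"
      using \<open>N > 0\<close> by (rule cong_mult_cancel_gcd)
    finally show ?thesis .
  qed
  have "orbit (long_cycle N ^^ k) x = {((long_cycle N ^^ k) ^^ m) x | m. m < ?d}"
    by (rule orbit_altdef_bounded) (use iff[of ?d 0] \<open>?d > 0\<close> in \<open>auto simp: cong_def\<close>)
  also have "\<dots> = (\<lambda>m. ((long_cycle N ^^ k) ^^ m) x) ` {..<?d}" by auto
  also have "card \<dots> = ?d"
    by (subst card_image) (auto simp: inj_on_def iff cong_def)
  finally show ?thesis .
qed

lemma cycle_type_long_cycle_funpow:
  assumes "N > 0"
  shows "cycle_type N (long_cycle N ^^ k) = replicate_mset (gcd k N) (N div gcd k N)"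
proof -
  have "N div gcd k N > 0" using assms by (simp add: div_greater_zero_iff)
  moreover have "N div (N div gcd k N) = gcd k N"
    using assms by (simp add: div_div_eq_right)
  ultimately show ?thesis
    using cycle_type_uniform[OF long_cycle_funpow_permutes[OF assms] card_orbit_long_cycle_funpow]
    by simp
qed

lemma cycle_type_conjugate:
  assumes \<pi>: "\<pi> permutes {1..N}"
  shows "cycle_type N (\<pi> \<circ> \<sigma> \<circ> inv \<pi>) = cycle_type N \<sigma>"
proof -
  have bij: "bij \<pi>" using \<pi> by (rule permutes_bij)
  then have inj: "inj \<pi>" by (rule bij_is_inj)
  have pow: "((\<pi> \<circ> \<sigma> \<circ> inv \<pi>) ^^ k) (\<pi> x) = \<pi> ((\<sigma> ^^ k) x)" for k x
    by (induction k) (auto simp: inv_f_f[OF inj])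
  have orb: "orbit (\<pi> \<circ> \<sigma> \<circ> inv \<pi>) (\<pi> x) = \<pi> ` orbit \<sigma> x" for x
    unfolding orbit_altdef pow by auto
  have "orbit (\<pi> \<circ> \<sigma> \<circ> inv \<pi>) ` {1..N} = orbit (\<pi> \<circ> \<sigma> \<circ> inv \<pi>) ` \<pi> ` {1..N}"
    using permutes_image[OF \<pi>] by simp
  also have "\<dots> = (`) \<pi> ` orbit \<sigma> ` {1..N}"
    by (simp add: image_image orb)
  finally have eq: "orbit (\<pi> \<circ> \<sigma> \<circ> inv \<pi>) ` {1..N} = (`) \<pi> ` orbit \<sigma> ` {1..N}" .
  have "inj_on ((`) \<pi>) (orbit \<sigma> ` {1..N})"
    using inj by (meson inj_image_eq_iff inj_onI)
  then have "cycle_type N (\<pi> \<circ> \<sigma> \<circ> inv \<pi>) =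
      image_mset card (image_mset ((`) \<pi>) (mset_set (orbit \<sigma> ` {1..N})))"
    unfolding cycle_type_def eq by (simp only: image_mset_mset_set)
  also have "\<dots> = cycle_type N \<sigma>"
    unfolding cycle_type_def multiset.map_comp comp_def
    by (rule image_mset_cong) (meson card_image inj inj_on_subset subset_UNIV)
  finally show ?thesis .
qed

lemma sum_apply_fun: "(\<Sum>i\<in>I. f i) x = (\<Sum>i\<in>I. f i x)"
  by (induction I rule: infinite_finite_induct) auto

section \<open>Constant series\<close>

lemma coeff_const_mult: "coeff (const c * F) M = c * coeff F M"
proof transfer
  fix c :: rat and F :: "nat multiset \<Rightarrow> rat" and M
  have "(\<Sum>(A, B)\<in>{(A, B). A + B = M}. (if A = {#} then c else 0) * F B) =
      (\<Sum>(A, B)\<in>{({#} :: nat multiset, M)}. (if A = {#} then c else 0) * F B)"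
    by (rule sum.mono_neutral_right) (auto simp: finite_splits split: if_splits)
  then show "(\<Sum>(A, B)\<in>{(A, B). A + B = M}. (if A = {#} then c else 0) * F B) = c * F M"
    by simp
qed

lemma const_add: "const (a + b) = const a + const b"
  by transfer auto

lemma const_mult: "const (a * b) = const a * const b"
  by (rule series_eqI) (simp add: coeff_const_mult, transfer, simp)

lemma const_0: "const 0 = 0"
  by transfer auto

lemma const_1: "const 1 = 1"
  by transfer auto

lemma const_sum: "const (sum f A) = (\<Sum>a\<in>A. const (f a))"
  by (induction A rule: infinite_finite_induct) (auto simp: const_add const_0)

lemma const_of_nat: "const (of_nat n) = of_nat n"
  by (induction n) (auto simp: const_add const_0 const_1)

lemma const_diff: "const (a - b) = const a - const b"
  by transfer auto

section \<open>Modules induced from the cyclic group\<close>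

text \<open>A finite-dimensional module \<open>V\<close> of the cyclic group of order \<open>N\<close>, whose generator acts by \<open>t\<close>. Finite
  dimension is expressed by a finite set \<open>E\<close> whose span contains \<open>V\<close>.\<close>

locale cyclic_module = vector_space scale
  for scale :: "rat \<Rightarrow> 'a::ab_group_add \<Rightarrow> 'a" +
  fixes N :: nat and V :: "'a set" and t :: "'a \<Rightarrow> 'a" and E :: "'a set"
  assumes N_pos: "N > 0"
    and subspace_V: "subspace V"
    and finite_E: "finite E" and V_le: "V \<subseteq> span E"
    and t_linear: "linear_on scale scale V t"
    and t_in: "t ` V \<subseteq> V"
    and t_power: "x \<in> V \<Longrightarrow> (t ^^ N) x = x"
begin

abbreviation rot :: "nat \<Rightarrow> nat" where "rot \<equiv> long_cycle N"

abbreviation W :: "((nat \<Rightarrow> nat) \<Rightarrow> 'a) set" where "W \<equiv> induced_space N V t"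

lemmas vs = vector_space_axioms

lemma induced_vector_space: "vector_space (induced_scale scale)"
  by unfold_locales
    (auto simp: induced_scale_def fun_eq_iff scale_right_distrib scale_left_distrib)

lemma tk_linear: "linear_on scale scale V (t ^^ k)" and tk_in: "x \<in> V \<Longrightarrow> (t ^^ k) x \<in> V"
  using linear_on_funpow[OF t_linear t_in, of k] by auto

lemma tk_0: "(t ^^ k) 0 = 0"
  by (rule linear_on_0[OF vs vs tk_linear]) (rule subspace_0[OF subspace_V])

lemma comp_rot_permutes:
  "\<pi> \<circ> (rot ^^ k) permutes {1..N} \<longleftrightarrow> \<pi> permutes {1..N}"
proof
  assume *: "\<pi> \<circ> (rot ^^ k) permutes {1..N}"
  have p: "(rot ^^ k) permutes {1..N}" by (rule long_cycle_funpow_permutes[OF N_pos])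
  have "\<pi> \<circ> (rot ^^ k) \<circ> inv (rot ^^ k) permutes {1..N}"
    by (rule permutes_compose[OF permutes_inv[OF p] *])
  then show "\<pi> permutes {1..N}"
    by (simp add: o_assoc[symmetric] permutes_inv_o(1)[OF p])
qed (rule permutes_compose[OF long_cycle_funpow_permutes[OF N_pos]])

lemma induced_subspace: "module.subspace (induced_scale scale) W"
proof -
  interpret W: vector_space "induced_scale scale" by (rule induced_vector_space)
  have "t 0 = 0" using tk_0[of 1] by simp
  moreover have "\<pi> \<circ> rot permutes {1..N} \<longleftrightarrow> \<pi> permutes {1..N}" for \<pi>
    using comp_rot_permutes[of \<pi> 1] by simp
  ultimately show ?thesis
    unfolding W.subspace_def induced_space_def
    using t_linear subspace_V
    by (auto simp: linear_on_def induced_scale_def subspace_0 subspace_add subspace_scale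
        simp del: One_nat_def)
qed

text \<open>The iterated equivariance condition: the values of an element of the induced module on one coset
  of the cyclic group determine each other.\<close>

lemma induced_space_rot_power:
  assumes "F \<in> W" "\<rho> permutes {1..N}"
  shows "(t ^^ k) (F (\<rho> \<circ> rot ^^ k)) = F \<rho>"
proof (induction k)
  case (Suc k)
  have "\<rho> \<circ> rot ^^ k permutes {1..N}" using assms(2) by (simp only: comp_rot_permutes)
  moreover have "\<rho> \<circ> rot ^^ Suc k = \<rho> \<circ> rot ^^ k \<circ> rot"
    by (simp only: funpow_Suc_right o_assoc)
  ultimately have *: "t (F (\<rho> \<circ> rot ^^ Suc k)) = F (\<rho> \<circ> rot ^^ k)"
    using assms by (auto simp: induced_space_def)
  have "(t ^^ Suc k) y = (t ^^ k) (t y)" for y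
    by (simp add: funpow_swap1)
  then show ?case
    by (simp only: * Suc.IH)
qed auto

text \<open>The function supported at the single permutation \<open>\<pi>\<close>, with value \<open>x\<close>, need not be equivariant. This
  is its average over the cyclic group, the projection to the induced module.\<close>

definition cyclic_average :: "(nat \<Rightarrow> nat) \<Rightarrow> 'a \<Rightarrow> (nat \<Rightarrow> nat) \<Rightarrow> 'a" where
  "cyclic_average \<pi> x \<rho> = (\<Sum>k<N. scale (if \<rho> \<circ> rot ^^ k = \<pi> then 1 / of_nat N else 0) ((t ^^ k) x))"

lemma cyclic_average_in:
  assumes "x \<in> V" "\<pi> permutes {1..N}"
  shows "cyclic_average \<pi> x \<in> W"
proof -
  have "cyclic_average \<pi> x \<rho> = 0" if "\<not> \<rho> permutes {1..N}" for \<rho>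
    unfolding cyclic_average_def using that assms comp_rot_permutes by (intro sum.neutral) auto
  moreover have "cyclic_average \<pi> x \<rho> \<in> V" for \<rho>
    unfolding cyclic_average_def using assms subspace_V tk_in
    by (intro subspace_sum subspace_scale) auto
  moreover have "t (cyclic_average \<pi> x (\<rho> \<circ> rot)) = cyclic_average \<pi> x \<rho>" for \<rho>
  proof -
    define g where
      "g k = scale (if \<rho> \<circ> rot ^^ k = \<pi> then 1 / of_nat N else 0) ((t ^^ k) x)" for k
    have "t (cyclic_average \<pi> x (\<rho> \<circ> rot)) =
        (\<Sum>k<N. scale (if \<rho> \<circ> rot \<circ> rot ^^ k = \<pi> then 1 / of_nat N else 0) (t ((t ^^ k) x)))"
      unfolding cyclic_average_def
      by (rule linear_on_sum_scale[OF vs vs t_linear subspace_V]) (use assms tk_in in auto)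
    also have "\<dots> = (\<Sum>k<N. g (Suc k))"
      unfolding g_def by (simp add: comp_assoc)
    \<comment> \<open>Shifting the summation index is harmless since \<open>g\<close> has period \<open>N\<close>.\<close>
    also have "\<dots> = (\<Sum>k<N. g k)"
    proof -
      have "g N = g 0" using assms by (simp add: g_def long_cycle_funpow_self[OF N_pos] t_power)
      then show ?thesis
        using sum.lessThan_Suc[of g N] sum.lessThan_Suc_shift[of g N] by simp
    qed
    finally show ?thesis by (simp add: cyclic_average_def g_def)
  qed
  ultimately show ?thesis by (auto simp: induced_space_def)
qed

text \<open>The averages of the values of \<open>F\<close> add up to \<open>F\<close>: a function is the sum of its restrictions to
  points, and averaging fixes the equivariant functions.\<close>

lemma sum_cyclic_average:
  assumes "F \<in> W"
  shows "(\<Sum>\<pi> | \<pi> permutes {1..N}. cyclic_average \<pi> (F \<pi>) \<rho>) = F \<rho>"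
proof (cases "\<rho> permutes {1..N}")
  case False
  then have "F \<rho> = 0" using assms by (auto simp: induced_space_def)
  have "cyclic_average \<pi> (F \<pi>) \<rho> = 0" if "\<pi> permutes {1..N}" for \<pi>
    using cyclic_average_in[of "F \<pi>" \<pi>] assms that False by (auto simp: induced_space_def)
  with \<open>F \<rho> = 0\<close> show ?thesis by simp
next
  case True
  have "(\<Sum>\<pi> | \<pi> permutes {1..N}. cyclic_average \<pi> (F \<pi>) \<rho>) =
      (\<Sum>k<N. \<Sum>\<pi> | \<pi> permutes {1..N}.
        scale (if \<rho> \<circ> rot ^^ k = \<pi> then 1 / of_nat N else 0) ((t ^^ k) (F \<pi>)))"
    unfolding cyclic_average_def by (rule sum.swap)
  also have "\<dots> = (\<Sum>k<N. scale (1 / of_nat N) (F \<rho>))"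
  proof (rule sum.cong)
    fix k
    have "(\<Sum>\<pi> | \<pi> permutes {1..N}.
        scale (if \<rho> \<circ> rot ^^ k = \<pi> then 1 / of_nat N else 0) ((t ^^ k) (F \<pi>))) =
        (\<Sum>\<pi> | \<pi> permutes {1..N}.
        if \<rho> \<circ> rot ^^ k = \<pi> then scale (1 / of_nat N) ((t ^^ k) (F \<pi>)) else 0)"
      by (rule sum.cong) auto
    also have "\<dots> = scale (1 / of_nat N) ((t ^^ k) (F (\<rho> \<circ> rot ^^ k)))"
      using True by (simp add: finite_permutations comp_rot_permutes del: One_nat_def)
    finally show "(\<Sum>\<pi> | \<pi> permutes {1..N}.
        scale (if \<rho> \<circ> rot ^^ k = \<pi> then 1 / of_nat N else 0) ((t ^^ k) (F \<pi>))) =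
        scale (1 / of_nat N) (F \<rho>)"
      using induced_space_rot_power[OF assms True] by simp
  qed simp
  also have "\<dots> = F \<rho>"
    using N_pos by (simp add: sum_constant_scale)
  finally show ?thesis .
qed

definition power_trace :: "nat \<Rightarrow> rat" where
  "power_trace k = trace_on scale V (t ^^ k)"

text \<open>The character formula for an induced module. The vectors \<open>cyclic_average \<pi> b\<close>, for all permutations
  \<open>\<pi>\<close> and all \<open>b\<close> in a basis \<open>B\<close> of \<open>V\<close>, together with the functionals that take the \<open>b\<close>-coordinate of the value at
  \<open>\<pi>\<close>, satisfy the hypotheses of \<open>trace_on_frame\<close>. They are linearly dependent in general: the
  permutations of one coset all contribute, which is balanced by the factor \<open>1/N\<close>.\<close>

lemma trace_induced_action:
  assumes \<sigma>: "\<sigma> permutes {1..N}"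
  shows "trace_on (induced_scale scale) W (induced_action \<sigma>) =
    (\<Sum>\<pi> | \<pi> permutes {1..N}. \<Sum>k<N.
       (if \<sigma> = \<pi> \<circ> rot ^^ k \<circ> inv \<pi> then 1 / of_nat N else 0) * power_trace k)"
proof -
  let ?S = "{\<pi>. \<pi> permutes {1..N}}"
  obtain B where B: "B \<subseteq> V" "independent B" "V \<subseteq> span B"
    using basis_exists[of V] by metis
  then have finB: "finite B"
    using independent_span_bound[OF finite_E B(2)] V_le by auto
  define \<phi> where "\<phi> b x = representation B x b" for b x
  have \<phi>: "linear_on scale (*) V (\<phi> b)" for b
    using B by (auto simp: linear_on_def \<phi>_def representation_add representation_scale subset_iff)
  have expand: "(\<Sum>b\<in>B. scale (\<phi> b x) b) = x" if "x \<in> V" for x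
    unfolding \<phi>_def using sum_representation_eq[OF B(2) _ finB] that B by auto
  have pt: "power_trace k = (\<Sum>b\<in>B. \<phi> b ((t ^^ k) b))" for k
    unfolding power_trace_def
    by (rule trace_on_frame[OF vs subspace_V finB _ \<phi> expand tk_linear])
       (use B tk_in in auto)
  \<comment> \<open>The diagonal entry at \<open>\<pi>\<close> is nonzero only if \<open>\<sigma>\<close> moves \<open>\<pi>\<close> within its coset, i.e. if \<open>\<sigma>\<close> is
      conjugate by \<open>\<pi>\<close> to a power of the long cycle.\<close>
  have conj: "inv \<sigma> \<circ> \<pi> \<circ> rot ^^ k = \<pi> \<longleftrightarrow> \<sigma> = \<pi> \<circ> rot ^^ k \<circ> inv \<pi>" if \<pi>: "\<pi> permutes {1..N}" for \<pi> k
  proof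
    assume "inv \<sigma> \<circ> \<pi> \<circ> rot ^^ k = \<pi>"
    then have "\<sigma> \<circ> (inv \<sigma> \<circ> \<pi> \<circ> rot ^^ k) \<circ> inv \<pi> = \<sigma> \<circ> \<pi> \<circ> inv \<pi>" by simp
    then have "(\<sigma> \<circ> inv \<sigma>) \<circ> (\<pi> \<circ> rot ^^ k \<circ> inv \<pi>) = \<sigma> \<circ> (\<pi> \<circ> inv \<pi>)"
      by (simp add: comp_assoc)
    then show "\<sigma> = \<pi> \<circ> rot ^^ k \<circ> inv \<pi>"
      by (simp add: permutes_inv_o[OF \<sigma>] permutes_inv_o[OF \<pi>])
  next
    assume \<sigma>eq: "\<sigma> = \<pi> \<circ> rot ^^ k \<circ> inv \<pi>"
    have "\<sigma> \<circ> \<pi> = \<pi> \<circ> rot ^^ k \<circ> (inv \<pi> \<circ> \<pi>)" by (simp add: \<sigma>eq comp_assoc)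
    then have "\<pi> \<circ> rot ^^ k = \<sigma> \<circ> \<pi>" by (simp add: permutes_inv_o[OF \<pi>])
    then have "inv \<sigma> \<circ> (\<pi> \<circ> rot ^^ k) = (inv \<sigma> \<circ> \<sigma>) \<circ> \<pi>" by (simp add: comp_assoc)
    then show "inv \<sigma> \<circ> \<pi> \<circ> rot ^^ k = \<pi>"
      by (simp add: permutes_inv_o[OF \<sigma>] comp_assoc)
  qed
  have tk_expand: "(\<Sum>b\<in>B. scale (\<phi> b x) ((t ^^ k) b)) = (t ^^ k) x" if "x \<in> V" for x k
  proof -
    have "(t ^^ k) (\<Sum>b\<in>B. scale (\<phi> b x) b) = (\<Sum>b\<in>B. scale (\<phi> b x) ((t ^^ k) b))"
      by (rule linear_on_sum_scale[OF vs vs tk_linear subspace_V]) (use B in auto)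
    then show ?thesis using expand[OF that] by simp
  qed
  have average_linear: "(\<Sum>b\<in>B. scale (\<phi> b x) (cyclic_average \<pi> b \<rho>)) = cyclic_average \<pi> x \<rho>" if "x \<in> V" for x \<pi> \<rho>
  proof -
    have "(\<Sum>b\<in>B. scale (\<phi> b x) (cyclic_average \<pi> b \<rho>)) =
        (\<Sum>k<N. scale (if \<rho> \<circ> rot ^^ k = \<pi> then 1 / of_nat N else 0)
           (\<Sum>b\<in>B. scale (\<phi> b x) ((t ^^ k) b)))"
      unfolding cyclic_average_def scale_sum_right
      by (subst sum.swap) (simp add: mult.commute)
    then show ?thesis by (simp add: cyclic_average_def tk_expand[OF that])
  qed
  have "trace_on (induced_scale scale) W (induced_action \<sigma>) =
     (\<Sum>i\<in>?S \<times> B. (\<lambda>(\<pi>, b) F. \<phi> b (F \<pi>)) i (induced_action \<sigma> ((\<lambda>(\<pi>, b). cyclic_average \<pi> b) i)))"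
  proof (rule trace_on_frame[OF induced_vector_space induced_subspace])
    show "finite (?S \<times> B)" using finB by (simp add: finite_permutations)
    show "(\<lambda>(\<pi>, b). cyclic_average \<pi> b) i \<in> W" if "i \<in> ?S \<times> B" for i
      using that B by (auto intro!: cyclic_average_in)
    show "linear_on (induced_scale scale) (*) W ((\<lambda>(\<pi>, b) F. \<phi> b (F \<pi>)) i)"
      if "i \<in> ?S \<times> B" for i
      using that \<phi> by (auto simp: linear_on_def induced_space_def induced_scale_def)
    show "linear_on (induced_scale scale) (induced_scale scale) W (induced_action \<sigma>)"
      by (auto simp: linear_on_def induced_action_def induced_scale_def)
    show "induced_action \<sigma> ` W \<subseteq> W"
    proof clarify
      fix F assume F: "F \<in> W"
      have "inv \<sigma> \<circ> \<pi> permutes {1..N} \<longleftrightarrow> \<pi> permutes {1..N}" for \<pi>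
      proof
        assume *: "inv \<sigma> \<circ> \<pi> permutes {1..N}"
        have "\<sigma> \<circ> (inv \<sigma> \<circ> \<pi>) permutes {1..N}" by (rule permutes_compose[OF * \<sigma>])
        then show "\<pi> permutes {1..N}"
          by (simp add: o_assoc permutes_inv_o[OF \<sigma>])
      qed (rule permutes_compose[OF _ permutes_inv[OF \<sigma>]])
      then show "induced_action \<sigma> F \<in> W"
        using F by (auto simp: induced_space_def induced_action_def o_assoc)
    qed
    show "(\<Sum>i\<in>?S \<times> B. induced_scale scale ((\<lambda>(\<pi>, b) F. \<phi> b (F \<pi>)) i F) ((\<lambda>(\<pi>, b). cyclic_average \<pi> b) i)) = F"
      if F: "F \<in> W" for F
    proof
      fix \<rho>
      have "(\<Sum>i\<in>?S \<times> B. induced_scale scale ((\<lambda>(\<pi>, b) F. \<phi> b (F \<pi>)) i F) ((\<lambda>(\<pi>, b). cyclic_average \<pi> b) i)) \<rho> =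
          (\<Sum>(\<pi>, b)\<in>?S \<times> B. scale (\<phi> b (F \<pi>)) (cyclic_average \<pi> b \<rho>))"
        by (simp add: sum_apply_fun induced_scale_def case_prod_unfold)
      also have "\<dots> = (\<Sum>\<pi>\<in>?S. \<Sum>b\<in>B. scale (\<phi> b (F \<pi>)) (cyclic_average \<pi> b \<rho>))"
        by (rule sum.cartesian_product [symmetric])
      also have "\<dots> = (\<Sum>\<pi>\<in>?S. cyclic_average \<pi> (F \<pi>) \<rho>)"
        using F by (intro sum.cong refl average_linear) (auto simp: induced_space_def)
      also have "\<dots> = F \<rho>" by (rule sum_cyclic_average[OF F])
      finally show "(\<Sum>i\<in>?S \<times> B. induced_scale scale ((\<lambda>(\<pi>, b) F. \<phi> b (F \<pi>)) i F) ((\<lambda>(\<pi>, b). cyclic_average \<pi> b) i)) \<rho> = F \<rho>" .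
    qed
  qed
  also have "\<dots> = (\<Sum>\<pi>\<in>?S. \<Sum>b\<in>B. \<phi> b (cyclic_average \<pi> b (inv \<sigma> \<circ> \<pi>)))"
    by (simp add: sum.cartesian_product induced_action_def case_prod_unfold)
  also have "\<dots> = (\<Sum>\<pi>\<in>?S. \<Sum>k<N.
       (if \<sigma> = \<pi> \<circ> rot ^^ k \<circ> inv \<pi> then 1 / of_nat N else 0) * power_trace k)"
  proof (rule sum.cong)
    fix \<pi> assume \<pi>: "\<pi> \<in> ?S"
    have "(\<Sum>b\<in>B. \<phi> b (cyclic_average \<pi> b (inv \<sigma> \<circ> \<pi>))) =
        (\<Sum>b\<in>B. \<Sum>k<N. (if inv \<sigma> \<circ> \<pi> \<circ> rot ^^ k = \<pi> then 1 / of_nat N else 0) * \<phi> b ((t ^^ k) b))"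
      unfolding cyclic_average_def
      by (intro sum.cong refl linear_on_sum_scale[OF vs vector_space_rat \<phi> subspace_V])
         (use B tk_in in auto)
    also have "\<dots> = (\<Sum>k<N. (if inv \<sigma> \<circ> \<pi> \<circ> rot ^^ k = \<pi> then 1 / of_nat N else 0) * power_trace k)"
      by (subst sum.swap) (simp add: pt sum_distrib_left)
    finally show "(\<Sum>b\<in>B. \<phi> b (cyclic_average \<pi> b (inv \<sigma> \<circ> \<pi>))) = (\<Sum>k<N.
       (if \<sigma> = \<pi> \<circ> rot ^^ k \<circ> inv \<pi> then 1 / of_nat N else 0) * power_trace k)"
      using \<pi> by (simp add: conj)
  qed simp
  finally show ?thesis .
qed

text \<open>Summing the character formula over \<open>\<sigma>\<close> first leaves, for each \<open>\<pi>\<close> and \<open>k\<close>, the cycle type of a conjugate of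
  \<open>rot ^^ k\<close>. This does not depend on \<open>\<pi>\<close>, so the sum over \<open>\<pi>\<close> cancels the factorial.\<close>

theorem frobenius_char_induced:
  "frobenius_char N (induced_scale scale) W induced_action =
     const (1 / of_nat N) *
     (\<Sum>k<N. const (power_trace k) * (\<Prod>j\<in>#cycle_type N (rot ^^ k). power_sum j))"
proof -
  let ?S = "{\<pi>. \<pi> permutes {1..N}}"
  let ?p = "\<lambda>\<sigma>. \<Prod>j\<in>#cycle_type N \<sigma>. power_sum j"
  have "(\<Sum>\<sigma>\<in>?S. const (trace_on (induced_scale scale) W (induced_action \<sigma>)) * ?p \<sigma>) =
      (\<Sum>\<sigma>\<in>?S. \<Sum>\<pi>\<in>?S. \<Sum>k<N.
         const ((if \<sigma> = \<pi> \<circ> rot ^^ k \<circ> inv \<pi> then 1 / of_nat N else 0) * power_trace k) * ?p \<sigma>)"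
    by (intro sum.cong refl) (simp add: trace_induced_action const_sum sum_distrib_right)
  also have "\<dots> = (\<Sum>\<pi>\<in>?S. \<Sum>k<N. \<Sum>\<sigma>\<in>?S.
         const ((if \<sigma> = \<pi> \<circ> rot ^^ k \<circ> inv \<pi> then 1 / of_nat N else 0) * power_trace k) * ?p \<sigma>)"
    by (subst sum.swap) (intro sum.cong refl sum.swap)
  also have "\<dots> = (\<Sum>\<pi>\<in>?S. \<Sum>k<N. const (1 / of_nat N * power_trace k) * ?p (rot ^^ k))"
  proof (intro sum.cong refl)
    fix \<pi> k assume "\<pi> \<in> ?S"
    then have \<pi>: "\<pi> permutes {1..N}" by simp
    have mem: "\<pi> \<circ> rot ^^ k \<circ> inv \<pi> permutes {1..N}"
      by (intro permutes_compose permutes_inv \<pi> long_cycle_funpow_permutes N_pos)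
    have "(\<Sum>\<sigma>\<in>?S. const ((if \<sigma> = \<pi> \<circ> rot ^^ k \<circ> inv \<pi> then 1 / of_nat N else 0) * power_trace k) * ?p \<sigma>) =
        (\<Sum>\<sigma>\<in>?S. if \<sigma> = \<pi> \<circ> rot ^^ k \<circ> inv \<pi> then const (1 / of_nat N * power_trace k) * ?p \<sigma> else 0)"
      by (intro sum.cong) (auto simp: const_0)
    also have "\<dots> = const (1 / of_nat N * power_trace k) * ?p (\<pi> \<circ> rot ^^ k \<circ> inv \<pi>)"
      using mem by (simp add: finite_permutations)
    finally show "(\<Sum>\<sigma>\<in>?S. const ((if \<sigma> = \<pi> \<circ> rot ^^ k \<circ> inv \<pi> then 1 / of_nat N else 0) * power_trace k) * ?p \<sigma>) =
        const (1 / of_nat N * power_trace k) * ?p (rot ^^ k)"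
      by (simp add: cycle_type_conjugate[OF \<pi>])
  qed
  also have "\<dots> = const (fact N) * (const (1 / of_nat N) * (\<Sum>k<N. const (power_trace k) * ?p (rot ^^ k)))"
  proof -
    have "card ?S = fact N" by (rule card_permutations) auto
    moreover have "of_nat (fact N) = const (fact N)"
      using const_of_nat[of "fact N"] by simp
    ultimately show ?thesis
      by (simp only: sum_constant const_mult sum_distrib_left mult.assoc)
  qed
  finally show ?thesis
    unfolding frobenius_char_def
    by (simp add: mult.assoc[symmetric] flip: const_mult)
qed

end

section \<open>The pointed leaf of a tree\<close>

text \<open>The relations of Dias preserve the leaf reached from the root by descending to the left at \<open>\<stileturn>\<close> and
  to the right at \<open>\<turnstile>\<close>. This is its position among the leaves, counted from 1.\<close>

fun pointer :: "dias_gen tree \<Rightarrow> nat" where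
  "pointer \<langle>\<rangle> = 1"
| "pointer (l \<stileturn> r) = pointer l"
| "pointer (l \<turnstile> r) = size1 l + pointer r"

text \<open>The pointed leaf of a graft at leaf \<open>i\<close>, when the lower tree points at leaf \<open>a\<close> and the grafted
  tree has \<open>n\<close> leaves and points at leaf \<open>b\<close>.\<close>

definition graft_pointer :: "nat \<Rightarrow> nat \<Rightarrow> nat \<Rightarrow> nat \<Rightarrow> nat" where
  "graft_pointer a i n b = (if i < a then a + n - 1 else if i = a then a + b - 1 else a)"

lemma pointer_bounds: "1 \<le> pointer t \<and> pointer t \<le> size1 t"
  by (induction t rule: pointer.induct) auto

lemma size1_pos: "1 \<le> size1 t"
  by (induction t) auto

lemma size1_graft: "1 \<le> i \<Longrightarrow> i \<le> size1 s \<Longrightarrow> size1 (graft s i t) = size1 s + size1 t - 1"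
proof (induction s i t rule: graft.induct)
  case (2 l x r i t)
  then show ?case using size1_pos[of l] size1_pos[of r] by auto
qed auto

lemma pointer_graft:
  "1 \<le> i \<Longrightarrow> i \<le> size1 s \<Longrightarrow>
    pointer (graft s i t) = graft_pointer (pointer s) i (size1 t) (pointer t)"
proof (induction s i t rule: graft.induct)
  case (2 l x r i t)
  then show ?case
    using pointer_bounds[of l] pointer_bounds[of r] pointer_bounds[of t] size1_pos[of t]
    by (cases x) (auto simp: graft_pointer_def size1_graft)
qed (auto simp: graft_pointer_def)

lemma graft_pointer_bounds:
  "\<lbrakk>1 \<le> a; a \<le> m; 1 \<le> b; b \<le> n; 1 \<le> i; i \<le> m\<rbrakk> \<Longrightarrow>
    1 \<le> graft_pointer a i n b \<and> graft_pointer a i n b \<le> m + n - 1"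
  by (auto simp: graft_pointer_def)

section \<open>Linear functionals on Dias\<close>

text \<open>The linear functional on the free operad that takes the value \<open>h (size1 t) (pointer t)\<close> at each
  tree \<open>t\<close>. Arbitrary \<open>h\<close> are needed for the induction over the ideal, where composition changes
  \<open>h\<close>.\<close>

definition pointer_eval :: "(nat \<Rightarrow> nat \<Rightarrow> rat) \<Rightarrow> (dias_gen tree \<Rightarrow>\<^sub>0 rat) \<Rightarrow> rat" where
  "pointer_eval h f =
     (\<Sum>t\<in>Poly_Mapping.keys f. Poly_Mapping.lookup f t * h (size1 t) (pointer t))"

lemma pointer_eval_superset:
  "finite A \<Longrightarrow> Poly_Mapping.keys f \<subseteq> A \<Longrightarrow>
    pointer_eval h f = (\<Sum>t\<in>A. Poly_Mapping.lookup f t * h (size1 t) (pointer t))"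
  unfolding pointer_eval_def by (rule sum.mono_neutral_left) (auto simp: in_keys_iff)

lemma pointer_eval_single:
  "pointer_eval h (Poly_Mapping.single t c) = c * h (size1 t) (pointer t)"
  by (subst pointer_eval_superset[of "{t}"]) auto

lemma pointer_eval_0: "pointer_eval h 0 = 0"
  by (simp add: pointer_eval_def)

lemma pointer_eval_add: "pointer_eval h (f + g) = pointer_eval h f + pointer_eval h g"
  using Poly_Mapping.keys_add[of f g]
  by (simp add: pointer_eval_superset[of "Poly_Mapping.keys f \<union> Poly_Mapping.keys g"]
      lookup_add distrib_right sum.distrib)

lemma pointer_eval_diff: "pointer_eval h (f - g) = pointer_eval h f - pointer_eval h g"
  using pointer_eval_add[of h "f - g" g] by simp

lemma keys_free_scale: "Poly_Mapping.keys (free_scale c f) \<subseteq> Poly_Mapping.keys f"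
  by (auto simp: in_keys_iff free_scale_lookup)

lemma pointer_eval_scale: "pointer_eval h (free_scale c f) = c * pointer_eval h f"
  using keys_free_scale[of c f]
  by (simp add: pointer_eval_superset[of "Poly_Mapping.keys f"]
      free_scale_lookup sum_distrib_left mult.assoc)

lemma pointer_eval_sum: "pointer_eval h (\<Sum>a\<in>A. f a) = (\<Sum>a\<in>A. pointer_eval h (f a))"
  by (induction A rule: infinite_finite_induct) (auto simp: pointer_eval_0 pointer_eval_add)

lemma pointer_eval_comp:
  "pointer_eval h (free_comp f i g) =
     (\<Sum>s\<in>Poly_Mapping.keys f. \<Sum>t\<in>Poly_Mapping.keys g.
        Poly_Mapping.lookup f s * (Poly_Mapping.lookup g t *
          (if 1 \<le> i \<and> i \<le> size1 s
           then h (size1 s + size1 t - 1) (graft_pointer (pointer s) i (size1 t) (pointer t))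
           else 0)))"
  unfolding free_comp_def pointer_eval_sum
  by (intro sum.cong refl)
     (auto simp: pointer_eval_single pointer_eval_0 size1_graft pointer_graft mult.assoc)

text \<open>Both sides of each relation have the same number of leaves and the same pointed leaf. The property
  passes to compositions since these data of a graft depend only on the data of its two parts:
  evaluating \<open>h\<close> on \<open>free_comp f i g\<close> amounts to evaluating another function of the same kind on \<open>f\<close>, or on
  \<open>g\<close>.\<close>

lemma pointer_eval_ideal: "f \<in> dias_ideal \<Longrightarrow> pointer_eval h f = 0"
proof (induction arbitrary: h rule: dias_ideal.induct)
  case (relation s t)
  then show ?case
    by (auto simp: dias_relations_def Let_def pointer_eval_diff pointer_eval_single
        numeral_2_eq_2 numeral_3_eq_3)
next
  case (comp_left f i g)
  have "pointer_eval h (free_comp f i g) =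
      pointer_eval (\<lambda>m a. \<Sum>t\<in>Poly_Mapping.keys g. Poly_Mapping.lookup g t *
          (if 1 \<le> i \<and> i \<le> m
           then h (m + size1 t - 1) (graft_pointer a i (size1 t) (pointer t)) else 0)) f"
    unfolding pointer_eval_comp unfolding pointer_eval_def sum_distrib_left by simp
  then show ?case by (simp only: comp_left.IH)
next
  case (comp_right g f i)
  have "pointer_eval h (free_comp f i g) =
      pointer_eval (\<lambda>n b. \<Sum>s\<in>Poly_Mapping.keys f. Poly_Mapping.lookup f s *
          (if 1 \<le> i \<and> i \<le> size1 s
           then h (size1 s + n - 1) (graft_pointer (pointer s) i n b) else 0)) g"
    unfolding pointer_eval_comp unfolding pointer_eval_def sum_distrib_left
    by (subst sum.swap) (simp add: mult.left_commute)
  then show ?case by (simp only: comp_right.IH)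
qed (auto simp: pointer_eval_0 pointer_eval_add pointer_eval_scale)

text \<open>The coordinate of an element with respect to the basis vector of arity \<open>n\<close> that points at leaf
  \<open>i\<close>.\<close>

lift_definition dias_coeff :: "nat \<Rightarrow> nat \<Rightarrow> dias \<Rightarrow> rat"
  is "\<lambda>n i. pointer_eval (\<lambda>m a. if m = n \<and> a = i then 1 else 0)"
  by (drule pointer_eval_ideal) (simp add: pointer_eval_diff)

lemma dias_eq_if_free_eq: "f = g \<Longrightarrow> f - g \<in> dias_ideal"
  by (simp add: dias_ideal.zero)

lemma dias_coeff_add: "dias_coeff n i (x + y) = dias_coeff n i x + dias_coeff n i y"
  by transfer (rule pointer_eval_add)

lemma dias_coeff_scale: "dias_coeff n i (dias_scale c x) = c * dias_coeff n i x"
  by transfer (rule pointer_eval_scale)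

section \<open>Composition in Dias is bilinear\<close>

lemma dias_comp_diff_left: "dias_comp (x - x') i y = dias_comp x i y - dias_comp x' i y"
  by transfer (rule dias_eq_if_free_eq, rule free_comp_diff_left)

lemma dias_comp_diff_right: "dias_comp x i (y - y') = dias_comp x i y - dias_comp x i y'"
  by transfer (rule dias_eq_if_free_eq, rule free_comp_diff_right)

lemma dias_comp_0_left [simp]: "dias_comp 0 i y = 0"
  using dias_comp_diff_left[of 0 0 i y] by simp

lemma dias_comp_0_right [simp]: "dias_comp x i 0 = 0"
  using dias_comp_diff_right[of x i 0 0] by simp

lemma dias_comp_minus_right: "dias_comp x i (- y) = - dias_comp x i y"
  using dias_comp_diff_right[of x i 0 y] by simp

lemma dias_comp_add_left: "dias_comp (x + x') i y = dias_comp x i y + dias_comp x' i y"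
  using dias_comp_diff_left[of x "- x'" i y] dias_comp_diff_left[of 0 x' i y] by simp

lemma dias_comp_add_right: "dias_comp x i (y + y') = dias_comp x i y + dias_comp x i y'"
  using dias_comp_diff_right[of x i y "- y'"] dias_comp_diff_right[of x i 0 y'] by simp

lemma free_scale_sum: "free_scale c (\<Sum>a\<in>A. f a) = (\<Sum>a\<in>A. free_scale c (f a))"
  by (rule poly_mapping_eqI) (simp add: free_scale_lookup lookup_sum sum_distrib_left)

lemma free_scale_0: "free_scale c 0 = 0"
  by (rule poly_mapping_eqI) (simp add: free_scale_lookup)

lemma free_scale_single: "free_scale c (Poly_Mapping.single t x) = Poly_Mapping.single t (c * x)"
  by (rule poly_mapping_eqI) (simp add: free_scale_lookup lookup_single when_def)

lemma free_comp_scale_left: "free_comp (free_scale c f) i g = free_scale c (free_comp f i g)"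
  unfolding free_comp_superset[OF finite_keys keys_free_scale finite_keys order_refl]
  unfolding free_comp_def free_scale_sum
  by (intro sum.cong refl) (auto simp: free_scale_lookup free_scale_single free_scale_0 mult.assoc)

lemma free_comp_scale_right: "free_comp f i (free_scale c g) = free_scale c (free_comp f i g)"
  unfolding free_comp_superset[OF finite_keys order_refl finite_keys keys_free_scale]
  unfolding free_comp_def free_scale_sum
  by (intro sum.cong refl)
     (auto simp: free_scale_lookup free_scale_single free_scale_0 mult.left_commute)

lemma dias_comp_scale_left: "dias_comp (dias_scale c x) i y = dias_scale c (dias_comp x i y)"
  by transfer (rule dias_eq_if_free_eq, rule free_comp_scale_left)

lemma dias_comp_scale_right: "dias_comp x i (dias_scale c y) = dias_scale c (dias_comp x i y)"
  by transfer (rule dias_eq_if_free_eq, rule free_comp_scale_right)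

section \<open>Normal forms\<close>

definition tree_class :: "dias_gen tree \<Rightarrow> dias" where
  "tree_class t = dias_class (Poly_Mapping.single t 1)"

lemma dias_comp_tree_class:
  "1 \<le> i \<Longrightarrow> i \<le> size1 s \<Longrightarrow> dias_comp (tree_class s) i (tree_class t) = tree_class (graft s i t)"
  by (simp add: tree_class_def dias_comp.abs_eq free_comp_def)

text \<open>A tree is obtained by grafting its subtrees onto a corolla. The right subtree is grafted first, as
  this does not move the left leaf.\<close>

lemma tree_class_node:
  "tree_class \<langle>l, x, r\<rangle> =
     dias_comp (dias_comp (tree_class \<langle>\<langle>\<rangle>, x, \<langle>\<rangle>\<rangle>) 2 (tree_class r)) 1 (tree_class l)"
  by (simp add: dias_comp_tree_class)

lemma tree_class_cong:
  "tree_class l = tree_class l' \<Longrightarrow> tree_class r = tree_class r' \<Longrightarrow>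
    tree_class \<langle>l, x, r\<rangle> = tree_class \<langle>l', x, r'\<rangle>"
  by (simp only: tree_class_node[of l x r] tree_class_node[of l' x r'])

text \<open>The defining relations are between trees with three leaves. Grafting onto these leaves, from right
  to left, gives the relations between arbitrary trees.\<close>

lemma tree_class_relation:
  assumes "(s, t) \<in> dias_relations"
  shows "tree_class (graft (graft (graft s 3 c) 2 b) 1 a) =
    tree_class (graft (graft (graft t 3 c) 2 b) 1 a)"
proof -
  have "size1 s = 3" "size1 t = 3"
    using assms by (auto simp: dias_relations_def Let_def)
  moreover have "tree_class s = tree_class t"
    unfolding tree_class_def using dias_ideal.relation[OF assms] by (simp add: dias.abs_eq_iff)
  moreover have "tree_class (graft (graft (graft u 3 c) 2 b) 1 a) =
      dias_comp (dias_comp (dias_comp (tree_class u) 3 (tree_class c)) 2 (tree_class b)) 1 (tree_class a)"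
    if "size1 u = 3" for u
    using that size1_pos[of c] size1_pos[of b] by (simp add: dias_comp_tree_class size1_graft)
  ultimately show ?thesis by simp
qed

lemma tree_class_relations:
  "tree_class (a \<stileturn> (b \<turnstile> c)) = tree_class (a \<stileturn> (b \<stileturn> c))"
  "tree_class (a \<stileturn> (b \<stileturn> c)) = tree_class ((a \<stileturn> b) \<stileturn> c)"
  "tree_class (a \<turnstile> (b \<stileturn> c)) = tree_class ((a \<turnstile> b) \<stileturn> c)"
  "tree_class (a \<turnstile> (b \<turnstile> c)) = tree_class ((a \<turnstile> b) \<turnstile> c)"
  "tree_class ((a \<turnstile> b) \<turnstile> c) = tree_class ((a \<stileturn> b) \<turnstile> c)"
proof -
  note * = tree_class_relation[of _ _ c b a, simplified dias_relations_def Let_def]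
  show "tree_class (a \<stileturn> (b \<turnstile> c)) = tree_class (a \<stileturn> (b \<stileturn> c))"
    using *[of "\<langle>\<rangle> \<stileturn> (\<langle>\<rangle> \<turnstile> \<langle>\<rangle>)" "\<langle>\<rangle> \<stileturn> (\<langle>\<rangle> \<stileturn> \<langle>\<rangle>)"] by simp
  show "tree_class (a \<stileturn> (b \<stileturn> c)) = tree_class ((a \<stileturn> b) \<stileturn> c)"
    using *[of "\<langle>\<rangle> \<stileturn> (\<langle>\<rangle> \<stileturn> \<langle>\<rangle>)" "(\<langle>\<rangle> \<stileturn> \<langle>\<rangle>) \<stileturn> \<langle>\<rangle>"] by simp
  show "tree_class (a \<turnstile> (b \<stileturn> c)) = tree_class ((a \<turnstile> b) \<stileturn> c)"
    using *[of "\<langle>\<rangle> \<turnstile> (\<langle>\<rangle> \<stileturn> \<langle>\<rangle>)" "(\<langle>\<rangle> \<turnstile> \<langle>\<rangle>) \<stileturn> \<langle>\<rangle>"] by simp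
  show "tree_class (a \<turnstile> (b \<turnstile> c)) = tree_class ((a \<turnstile> b) \<turnstile> c)"
    using *[of "\<langle>\<rangle> \<turnstile> (\<langle>\<rangle> \<turnstile> \<langle>\<rangle>)" "(\<langle>\<rangle> \<turnstile> \<langle>\<rangle>) \<turnstile> \<langle>\<rangle>"] by simp
  show "tree_class ((a \<turnstile> b) \<turnstile> c) = tree_class ((a \<stileturn> b) \<turnstile> c)"
    using *[of "(\<langle>\<rangle> \<turnstile> \<langle>\<rangle>) \<turnstile> \<langle>\<rangle>" "(\<langle>\<rangle> \<stileturn> \<langle>\<rangle>) \<turnstile> \<langle>\<rangle>"] by simp
qed

text \<open>A left comb with \<open>n + 1\<close> leaves that points at leaf \<open>i\<close>, used as the normal form of such trees. With
  \<open>\<turnstile>\<close> at the root the class does not depend on where the left subtree points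
  (\<open>comb_vdash_leaf\<close>); the last leaf is an arbitrary choice.\<close>

primrec comb :: "nat \<Rightarrow> nat \<Rightarrow> dias_gen tree" where
  "comb 0 i = \<langle>\<rangle>"
| "comb (Suc n) i = (if i \<le> Suc n then comb n i \<stileturn> \<langle>\<rangle> else comb n (Suc n) \<turnstile> \<langle>\<rangle>)"

lemma size1_comb: "size1 (comb n i) = Suc n"
  by (induction n arbitrary: i) auto

lemma pointer_comb: "1 \<le> i \<Longrightarrow> i \<le> Suc n \<Longrightarrow> pointer (comb n i) = i"
  by (induction n arbitrary: i) (auto simp: size1_comb)

text \<open>The left argument of \<open>\<turnstile>\<close> forgets its pointed leaf: by the last relation the type of its root
  is immaterial, and so are, inductively, the types of all its nodes.\<close>

lemma comb_vdash_leaf: "tree_class (comb p a \<turnstile> \<langle>\<rangle>) = tree_class (comb p (Suc p) \<turnstile> \<langle>\<rangle>)"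
proof (induction p arbitrary: a)
  case 0
  show ?case by (simp only: comb.simps)
next
  case (Suc p)
  have top: "comb (Suc p) (Suc (Suc p)) = comb p (Suc p) \<turnstile> \<langle>\<rangle>" by simp
  show ?case
  proof (cases "a \<le> Suc p")
    case True
    then have "comb (Suc p) a = comb p a \<stileturn> \<langle>\<rangle>" by simp
    then have "tree_class (comb (Suc p) a \<turnstile> \<langle>\<rangle>) = tree_class ((comb p a \<turnstile> \<langle>\<rangle>) \<turnstile> \<langle>\<rangle>)"
      by (simp only: tree_class_relations(5))
    also have "\<dots> = tree_class ((comb p (Suc p) \<turnstile> \<langle>\<rangle>) \<turnstile> \<langle>\<rangle>)"
      by (rule tree_class_cong[OF Suc.IH refl])
    finally show ?thesis by (simp only: top)
  next
    case False
    then have "comb (Suc p) a = comb p (Suc p) \<turnstile> \<langle>\<rangle>" by simp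
    then show ?thesis by (simp only: top)
  qed
qed

text \<open>Moving the right comb leaf by leaf to the left part by the first two relations shows that its pointed
  leaf is forgotten.\<close>

lemma comb_dashv:
  "a \<le> Suc p \<Longrightarrow> tree_class (comb p a \<stileturn> comb q b) = tree_class (comb (Suc (p + q)) a)"
proof (induction q arbitrary: b)
  case (Suc q)
  have *: "tree_class ((comb p a \<stileturn> comb q b') \<stileturn> \<langle>\<rangle>) = tree_class (comb (Suc (p + Suc q)) a)" for b'
    using tree_class_cong[OF Suc.IH[OF Suc.prems] refl, of b' Dashv "\<langle>\<rangle>"] Suc.prems by simp
  then show ?case
    by (simp add: tree_class_relations(1,2))
qed simp

lemma comb_vdash:
  "1 \<le> b \<Longrightarrow> b \<le> Suc q \<Longrightarrow>
    tree_class (comb p a \<turnstile> comb q b) = tree_class (comb (Suc (p + q)) (Suc p + b))"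
proof (induction q arbitrary: b)
  case 0
  then have "b = 1" by simp
  then show ?case using comb_vdash_leaf[of p a] by simp
next
  case (Suc q)
  show ?case
  proof (cases "b \<le> Suc q")
    case True
    have "tree_class (comb p a \<turnstile> comb (Suc q) b) = tree_class ((comb p a \<turnstile> comb q b) \<stileturn> \<langle>\<rangle>)"
      using True by (simp add: tree_class_relations(3))
    also have "\<dots> = tree_class (comb (Suc (p + q)) (Suc p + b) \<stileturn> \<langle>\<rangle>)"
      by (rule tree_class_cong[OF Suc.IH[OF Suc.prems(1) True] refl])
    finally show ?thesis using True by simp
  next
    case False
    then have b: "b = Suc (Suc q)" using Suc.prems by simp
    have "tree_class (comb p a \<turnstile> comb (Suc q) b) =
        tree_class ((comb p a \<turnstile> comb q (Suc q)) \<turnstile> \<langle>\<rangle>)"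
      using b by (simp add: tree_class_relations(4))
    also have "\<dots> = tree_class (comb (Suc (p + q)) (Suc p + Suc q) \<turnstile> \<langle>\<rangle>)"
      by (rule tree_class_cong[OF Suc.IH refl]) auto
    finally show ?thesis using b by simp
  qed
qed

lemma tree_class_comb: "tree_class t = tree_class (comb (size1 t - 1) (pointer t))"
proof (induction t)
  case (Node l x r)
  obtain p q where pq: "size1 l = Suc p" "size1 r = Suc q"
    using size1_pos[of l] size1_pos[of r] by (cases "size1 l"; cases "size1 r") auto
  have "tree_class \<langle>l, x, r\<rangle> = tree_class \<langle>comb p (pointer l), x, comb q (pointer r)\<rangle>"
    using Node pq by (intro tree_class_cong) auto
  also have "\<dots> = tree_class (comb (size1 \<langle>l, x, r\<rangle> - 1) (pointer \<langle>l, x, r\<rangle>))"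
    using pq pointer_bounds[of l] pointer_bounds[of r]
    by (cases x) (auto simp: comb_dashv comb_vdash)
  finally show ?case .
qed simp

section \<open>The basis of Dias\<close>

text \<open>The basis vectors are those with \<open>1 \<le> i \<le> n\<close>. The value \<open>0\<close> for \<open>i = 0\<close> makes the formula for the
  rotation uniform in \<open>i\<close>, and lets the index be read modulo \<open>n + 1\<close> (see \<open>cyclic_basis\<close>).\<close>

definition dias_basis :: "nat \<Rightarrow> nat \<Rightarrow> dias" where
  "dias_basis n i = (if i = 0 then 0 else tree_class (comb (n - 1) i))"

lemma dias_basis_0 [simp]: "dias_basis n 0 = 0"
  by (simp add: dias_basis_def)

lemma tree_class_eq_basis: "tree_class t = dias_basis (size1 t) (pointer t)"
  using tree_class_comb[of t] pointer_bounds[of t] by (auto simp: dias_basis_def)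

interpretation dias: vector_space dias_scale
  by (rule vector_space_dias)

lemma dias_class_expand:
  "dias_class f =
    (\<Sum>t\<in>Poly_Mapping.keys f. dias_scale (Poly_Mapping.lookup f t) (tree_class t))"
proof -
  have sum: "dias_class (\<Sum>a\<in>A. g a) = (\<Sum>a\<in>A. dias_class (g a))" for A and g :: "dias_gen tree \<Rightarrow> _"
    by (induction A rule: infinite_finite_induct)
       (auto simp: zero_dias.abs_eq plus_dias.abs_eq[symmetric])
  have *: "f = (\<Sum>t\<in>Poly_Mapping.keys f. Poly_Mapping.single t (Poly_Mapping.lookup f t))"
    by (rule poly_mapping_eqI) (simp add: lookup_sum lookup_single when_def in_keys_iff)
  have "dias_class f =
      (\<Sum>t\<in>Poly_Mapping.keys f. dias_class (Poly_Mapping.single t (Poly_Mapping.lookup f t)))"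
    unfolding sum[symmetric] by (rule arg_cong[OF *])
  then show ?thesis
    by (simp add: tree_class_def dias_scale.abs_eq free_scale_single)
qed

lemma dias_coeff_basis:
  "1 \<le> j \<Longrightarrow> j \<le> n \<Longrightarrow> dias_coeff n i (dias_basis n j) = (if i = j then 1 else 0)"
  by (simp add: dias_basis_def tree_class_def dias_coeff.abs_eq pointer_eval_single
      size1_comb pointer_comb)

lemma subspace_Dias: "dias.subspace (Dias n)"
proof (rule dias.subspaceI)
  show "0 \<in> Dias n"
    unfolding Dias_def zero_dias.abs_eq by (rule imageI) simp
  fix x y assume "x \<in> Dias n" "y \<in> Dias n"
  then obtain f g where "x = dias_class f" "\<forall>t\<in>Poly_Mapping.keys f. size1 t = n"
    "y = dias_class g" "\<forall>t\<in>Poly_Mapping.keys g. size1 t = n"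
    unfolding Dias_def by auto
  then show "x + y \<in> Dias n"
    using Poly_Mapping.keys_add[of f g]
    by (auto simp: Dias_def plus_dias.abs_eq intro!: imageI)
next
  fix c x assume "x \<in> Dias n"
  then obtain f where "x = dias_class f" "\<forall>t\<in>Poly_Mapping.keys f. size1 t = n"
    unfolding Dias_def by auto
  then show "dias_scale c x \<in> Dias n"
    using keys_free_scale[of c f]
    by (auto simp: Dias_def dias_scale.abs_eq intro!: imageI)
qed

lemma tree_class_in_Dias: "tree_class t \<in> Dias (size1 t)"
  unfolding tree_class_def Dias_def by (rule imageI) simp

lemma dias_basis_in: "i \<le> n \<Longrightarrow> dias_basis n i \<in> Dias n"
  using tree_class_in_Dias[of "comb (n - 1) i"] dias.subspace_0[OF subspace_Dias]
  by (auto simp: dias_basis_def size1_comb)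

text \<open>With this rule, an identity that is linear in each argument is reduced to basis vectors.\<close>

lemma Dias_induct [consumes 1, case_names zero add scale basis]:
  assumes "x \<in> Dias n" "P 0" "\<And>x y. P x \<Longrightarrow> P y \<Longrightarrow> P (x + y)"
    "\<And>c x. P x \<Longrightarrow> P (dias_scale c x)" "\<And>i. 1 \<le> i \<Longrightarrow> i \<le> n \<Longrightarrow> P (dias_basis n i)"
  shows "P x"
proof -
  obtain f where f: "x = dias_class f" "\<forall>t\<in>Poly_Mapping.keys f. size1 t = n"
    using assms(1) unfolding Dias_def by auto
  have "P (\<Sum>t\<in>A. dias_scale (c t) (tree_class t))" if "\<forall>t\<in>A. size1 t = n" for A c
    using that
  proof (induction A rule: infinite_finite_induct)
    case (insert t A)
    then show ?case
      using assms(3-5) pointer_bounds[of t] by (simp add: tree_class_eq_basis)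
  qed (use assms(2) in auto)
  then show ?thesis using f by (simp add: dias_class_expand[of f])
qed

lemma dias_expand:
  assumes "x \<in> Dias n"
  shows "(\<Sum>i\<in>{1..n}. dias_scale (dias_coeff n i x) (dias_basis n i)) = x"
  using assms
proof (induction rule: Dias_induct)
  case zero
  have "dias_coeff n i 0 = 0" for i
    using dias_coeff_scale[of n i 0 0] by simp
  then show ?case by simp
next
  case (basis j)
  have "(\<Sum>i\<in>{1..n}. dias_scale (dias_coeff n i (dias_basis n j)) (dias_basis n i)) =
      (\<Sum>i\<in>{1..n}. if i = j then dias_basis n i else 0)"
    using basis by (intro sum.cong) (auto simp: dias_coeff_basis)
  then show ?case using basis by simp
next
  case (add x y)
  then show ?case by (simp add: dias_coeff_add dias.scale_left_distrib sum.distrib)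
next
  case (scale c x)
  have "(\<Sum>i\<in>{1..n}. dias_scale (dias_coeff n i (dias_scale c x)) (dias_basis n i)) =
      dias_scale c (\<Sum>i\<in>{1..n}. dias_scale (dias_coeff n i x) (dias_basis n i))"
    by (simp add: dias_coeff_scale dias.scale_sum_right)
  then show ?case by (simp only: scale)
qed

text \<open>The case \<open>a = 0\<close> is included: both sides vanish then.\<close>

lemma dias_comp_basis:
  assumes "a \<le> m" "1 \<le> b" "b \<le> n" "1 \<le> i" "i \<le> m"
  shows "dias_comp (dias_basis m a) i (dias_basis n b) =
    dias_basis (m + n - 1) (graft_pointer a i n b)"
proof (cases "a = 0")
  case False
  then have "size1 (comb (m - 1) a) = m" "pointer (comb (m - 1) a) = a"
    "size1 (comb (n - 1) b) = n" "pointer (comb (n - 1) b) = b"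
    using assms by (auto simp: size1_comb pointer_comb)
  with False assms show ?thesis
    by (simp add: dias_basis_def[of m] dias_basis_def[of n] dias_comp_tree_class
        tree_class_eq_basis[of "graft _ _ _"] size1_graft pointer_graft)
qed (use assms in \<open>auto simp: graft_pointer_def\<close>)

section \<open>The anticyclic operad Dias\<close>

lemma dias_unit_eq: "dias_unit = dias_basis 1 1"
  by (simp add: dias_unit_def dias_basis_def tree_class_def)

lemma dias_dashv_eq: "dias_dashv = dias_basis 2 1"
  by (simp add: dias_dashv_def dias_basis_def tree_class_def numeral_2_eq_2)

lemma dias_vdash_eq: "dias_vdash = dias_basis 2 2"
  by (simp add: dias_vdash_def dias_basis_def tree_class_def numeral_2_eq_2)

lemmas dias_comp_bilinear =
  dias_comp_add_left dias_comp_add_right dias_comp_scale_left dias_comp_scale_right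

lemma dias_comp_in:
  assumes "f \<in> Dias m" "g \<in> Dias n" "1 \<le> i" "i \<le> m"
  shows "dias_comp f i g \<in> Dias (m + n - 1)"
  using assms(1)
proof (induction rule: Dias_induct)
  case (basis a)
  from assms(2) show ?case
  proof (induction rule: Dias_induct)
    case (basis b)
    then show ?case
      using \<open>1 \<le> a\<close> \<open>a \<le> m\<close> assms graft_pointer_bounds[of a m b n i]
      by (simp add: dias_comp_basis dias_basis_in)
  qed (auto simp: dias_comp_bilinear intro: dias.subspace_0 dias.subspace_add dias.subspace_scale subspace_Dias)
qed (auto simp: dias_comp_bilinear intro: dias.subspace_0 dias.subspace_add dias.subspace_scale subspace_Dias)

lemma dias_unit_comp:
  assumes "g \<in> Dias n"
  shows "dias_comp dias_unit 1 g = g"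
  using assms
  by (induction rule: Dias_induct)
    (auto simp: dias_comp_bilinear dias_unit_eq dias_comp_basis graft_pointer_def)

lemma dias_comp_unit:
  assumes "f \<in> Dias m" "1 \<le> i" "i \<le> m"
  shows "dias_comp f i dias_unit = f"
  using assms(1)
  by (induction rule: Dias_induct)
    (use assms in \<open>auto simp: dias_comp_bilinear dias_unit_eq dias_comp_basis graft_pointer_def\<close>)

lemma graft_pointer_sequential:
  assumes "1 \<le> a" "a \<le> l" "1 \<le> b" "b \<le> m" "1 \<le> c" "c \<le> n" "1 \<le> i" "i \<le> l" "1 \<le> j" "j \<le> m"
  shows "graft_pointer (graft_pointer a i m b) (i + j - 1) n c =
    graft_pointer a i (m + n - 1) (graft_pointer b j n c)"
proof -
  obtain a' b' j' m' n' where "a = Suc a'" "b = Suc b'" "j = Suc j'" "m = Suc m'" "n = Suc n'"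
    using assms by (metis Suc_le_D One_nat_def)
  then show ?thesis
    using assms by (auto simp: graft_pointer_def)
qed

lemma graft_pointer_parallel:
  assumes "1 \<le> a" "a \<le> l" "1 \<le> b" "b \<le> m" "1 \<le> c" "c \<le> n" "1 \<le> i" "i < k" "k \<le> l"
  shows "graft_pointer (graft_pointer a i m b) (k + m - 1) n c =
    graft_pointer (graft_pointer a k n c) i m b"
proof -
  obtain a' b' c' m' n' where "a = Suc a'" "b = Suc b'" "c = Suc c'" "m = Suc m'" "n = Suc n'"
    using assms by (metis Suc_le_D One_nat_def)
  then show ?thesis
    using assms by (auto simp: graft_pointer_def)
qed
lemma dias_comp_sequential:
  assumes f: "f \<in> Dias l" and g: "g \<in> Dias m" and h: "h \<in> Dias n"
    and ij: "1 \<le> i" "i \<le> l" "1 \<le> j" "j \<le> m"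
  shows "dias_comp (dias_comp f i g) (i + j - 1) h = dias_comp f i (dias_comp g j h)"
  using f
proof (induction rule: Dias_induct)
  case a: (basis a)
  from g show ?case
  proof (induction rule: Dias_induct)
    case b: (basis b)
    from h show ?case
    proof (induction rule: Dias_induct)
      case c: (basis c)
      have ab: "1 \<le> graft_pointer a i m b" "graft_pointer a i m b \<le> l + m - 1"
        and bc: "1 \<le> graft_pointer b j n c" "graft_pointer b j n c \<le> m + n - 1"
        using graft_pointer_bounds[OF a b ij(1,2)] graft_pointer_bounds[OF b c ij(3,4)] by blast+
      have pos: "1 \<le> i + j - 1" "i + j - 1 \<le> l + m - 1" using ij by linarith+
      have "dias_comp (dias_comp (dias_basis l a) i (dias_basis m b)) (i + j - 1) (dias_basis n c) =
          dias_basis (l + m - 1 + n - 1) (graft_pointer (graft_pointer a i m b) (i + j - 1) n c)"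
        by (simp only: dias_comp_basis[OF a(2) b ij(1,2)] dias_comp_basis[OF ab(2) c pos])
      also have "graft_pointer (graft_pointer a i m b) (i + j - 1) n c =
          graft_pointer a i (m + n - 1) (graft_pointer b j n c)"
        by (rule graft_pointer_sequential[OF a b c ij])
      also have "l + m - 1 + n - 1 = l + (m + n - 1) - 1" using b c by linarith
      also have "dias_basis (l + (m + n - 1) - 1) (graft_pointer a i (m + n - 1) (graft_pointer b j n c)) =
          dias_comp (dias_basis l a) i (dias_comp (dias_basis m b) j (dias_basis n c))"
        by (simp only: dias_comp_basis[OF b(2) c ij(3,4)] dias_comp_basis[OF a(2) bc ij(1,2)])
      finally show ?case .
    qed (simp_all add: dias_comp_bilinear)
  qed (simp_all add: dias_comp_bilinear)
qed (simp_all add: dias_comp_bilinear)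

lemma dias_comp_parallel:
  assumes f: "f \<in> Dias l" and g: "g \<in> Dias m" and h: "h \<in> Dias n"
    and ik: "1 \<le> i" "i < k" "k \<le> l"
  shows "dias_comp (dias_comp f i g) (k + m - 1) h = dias_comp (dias_comp f k h) i g"
  using f
proof (induction rule: Dias_induct)
  case a: (basis a)
  from g show ?case
  proof (induction rule: Dias_induct)
    case b: (basis b)
    from h show ?case
    proof (induction rule: Dias_induct)
      case c: (basis c)
      have i: "1 \<le> i" "i \<le> l" and k: "1 \<le> k" "k \<le> l" using ik by linarith+
      have ab: "graft_pointer a i m b \<le> l + m - 1" and ac: "graft_pointer a k n c \<le> l + n - 1"
        using graft_pointer_bounds[OF a b i] graft_pointer_bounds[OF a c k] by blast+
      have pos: "1 \<le> k + m - 1" "k + m - 1 \<le> l + m - 1" "i \<le> l + n - 1"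
        using ik b c by linarith+
      have "dias_comp (dias_comp (dias_basis l a) i (dias_basis m b)) (k + m - 1) (dias_basis n c) =
          dias_basis (l + m - 1 + n - 1) (graft_pointer (graft_pointer a i m b) (k + m - 1) n c)"
        by (simp only: dias_comp_basis[OF a(2) b i] dias_comp_basis[OF ab c pos(1,2)])
      also have "graft_pointer (graft_pointer a i m b) (k + m - 1) n c =
          graft_pointer (graft_pointer a k n c) i m b"
        by (rule graft_pointer_parallel[OF a b c ik])
      also have "l + m - 1 + n - 1 = l + n - 1 + m - 1" using b c by linarith
      also have "dias_basis (l + n - 1 + m - 1) (graft_pointer (graft_pointer a k n c) i m b) =
          dias_comp (dias_comp (dias_basis l a) k (dias_basis n c)) i (dias_basis m b)"
        by (simp only: dias_comp_basis[OF a(2) c k] dias_comp_basis[OF ac b ik(1) pos(3)])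
      finally show ?case .
    qed (simp_all add: dias_comp_bilinear)
  qed (simp_all add: dias_comp_bilinear)
qed (simp_all add: dias_comp_bilinear)

lemma ns_operad_Dias: "ns_operad dias_scale Dias dias_comp dias_unit"
proof (intro ns_operad.intro ns_operad_axioms.intro)
  show "dias_unit \<in> Dias 1"
    unfolding dias_unit_eq by (rule dias_basis_in) simp
qed (rule vector_space_dias subspace_Dias dias_comp_in dias_comp_add_left dias_comp_add_right
  dias_comp_scale_left dias_comp_scale_right dias_unit_comp dias_comp_unit
  dias_comp_sequential dias_comp_parallel; assumption)+

text \<open>The linear map with \<open>e\<^sub>i \<mapsto> e\<^sub>i\<^sub>-\<^sub>1 - e\<^sub>n\<close>; it turns out to be the rotation of Dias.\<close>

definition rotate_dias :: "nat \<Rightarrow> dias \<Rightarrow> dias" where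
  "rotate_dias n x =
     (\<Sum>i\<in>{1..n}. dias_scale (dias_coeff n i x) (dias_basis n (i - 1) - dias_basis n n))"

lemma rotate_dias_add: "rotate_dias n (x + y) = rotate_dias n x + rotate_dias n y"
  by (simp add: rotate_dias_def dias_coeff_add dias.scale_left_distrib sum.distrib)

lemma rotate_dias_scale: "rotate_dias n (dias_scale c x) = dias_scale c (rotate_dias n x)"
  by (simp add: rotate_dias_def dias_coeff_scale dias.scale_sum_right)

lemma rotate_dias_0: "rotate_dias n 0 = 0"
  using rotate_dias_add[of n 0 0] by simp

lemma rotate_dias_diff: "rotate_dias n (x - y) = rotate_dias n x - rotate_dias n y"
  using rotate_dias_add[of n "x - y" y] by simp

lemma rotate_dias_basis:
  assumes "1 \<le> j" "j \<le> n"
  shows "rotate_dias n (dias_basis n j) = dias_basis n (j - 1) - dias_basis n n"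
proof -
  have "rotate_dias n (dias_basis n j) =
      (\<Sum>i\<in>{1..n}. if i = j then dias_basis n (i - 1) - dias_basis n n else 0)"
    unfolding rotate_dias_def using assms by (intro sum.cong) (auto simp: dias_coeff_basis)
  then show ?thesis using assms by simp
qed

lemma rotate_dias_in: "rotate_dias n x \<in> Dias n"
  unfolding rotate_dias_def
  by (intro dias.subspace_sum[OF subspace_Dias] dias.subspace_scale[OF subspace_Dias]
      dias.subspace_diff[OF subspace_Dias] dias_basis_in) auto

text \<open>The vectors \<open>e\<^sub>0 = 0, e\<^sub>1, \<dots>, e\<^sub>n\<close> indexed modulo \<open>n + 1\<close>. They behave like differences \<open>v\<^sub>j - v\<^sub>0\<close>, where the
  rotation maps \<open>v\<^sub>j\<close> to \<open>v\<^sub>j\<^sub>-\<^sub>1\<close>; this form has no exceptional indices, which makes it easy to iterate.\<close>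

definition cyclic_basis :: "nat \<Rightarrow> int \<Rightarrow> dias" where
  "cyclic_basis n j = dias_basis n (nat (j mod (int n + 1)))"

lemma cyclic_basis_of_nat: "j \<le> n \<Longrightarrow> cyclic_basis n (int j) = dias_basis n j"
  by (simp add: cyclic_basis_def)

lemma cyclic_basis_cong: "[i = j] (mod (int n + 1)) \<Longrightarrow> cyclic_basis n i = cyclic_basis n j"
  by (simp add: cyclic_basis_def cong_def)

lemma cyclic_basis_m1: "cyclic_basis n (- 1) = dias_basis n n"
proof -
  have "cyclic_basis n (- 1) = cyclic_basis n (int n)"
    by (rule cyclic_basis_cong, rule cong_sym) (simp add: cong_iff_dvd_diff add.commute)
  then show ?thesis by (simp add: cyclic_basis_of_nat)
qed

lemma cyclic_basis_0: "cyclic_basis n 0 = 0"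
  by (simp add: cyclic_basis_def)

lemma rotate_dias_cyclic_basis:
  "rotate_dias n (cyclic_basis n j) = cyclic_basis n (j - 1) - cyclic_basis n (- 1)"
proof -
  define i where "i = nat (j mod (int n + 1))"
  have i: "i \<le> n" "[int i = j] (mod (int n + 1))"
    using pos_mod_bound[of "int n + 1" j] by (auto simp: i_def cong_def)
  then have j: "cyclic_basis n j = dias_basis n i"
    using cyclic_basis_cong[of "int i" j n] by (simp add: cyclic_basis_of_nat)
  show ?thesis
  proof (cases "i = 0")
    case True
    then have "cyclic_basis n (j - 1) = cyclic_basis n (- 1)"
      using i by (intro cyclic_basis_cong) (auto simp: cong_iff_dvd_diff dvd_diff_commute)
    then show ?thesis using True j by (simp add: rotate_dias_0)
  next
    case False
    have "[int (i - 1) = j - 1] (mod (int n + 1))"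
      using i False by (simp add: of_nat_diff cong_diff)
    then have "cyclic_basis n (j - 1) = dias_basis n (i - 1)"
      using cyclic_basis_cong[of "int (i - 1)" "j - 1" n] i by (simp add: cyclic_basis_of_nat)
    then show ?thesis using False i j by (simp add: rotate_dias_basis cyclic_basis_m1)
  qed
qed

lemma rotate_dias_power:
  "(rotate_dias n ^^ k) (cyclic_basis n j) = cyclic_basis n (j - int k) - cyclic_basis n (- int k)"
proof (induction k)
  case (Suc k)
  have "j - int (Suc k) = j - int k - 1" "- int (Suc k) = - int k - 1" by simp_all
  then show ?case
    by (simp only: funpow.simps o_apply Suc.IH rotate_dias_diff rotate_dias_cyclic_basis) simp
qed (simp add: cyclic_basis_0)

lemma rotate_dias_power_linear:
  "(rotate_dias n ^^ k) (x + y) = (rotate_dias n ^^ k) x + (rotate_dias n ^^ k) y"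
  "(rotate_dias n ^^ k) (dias_scale c x) = dias_scale c ((rotate_dias n ^^ k) x)"
  "(rotate_dias n ^^ k) 0 = 0"
  by (induction k) (simp_all add: rotate_dias_add rotate_dias_scale rotate_dias_0)

lemma rotate_dias_order:
  assumes "f \<in> Dias n"
  shows "(rotate_dias n ^^ (n + 1)) f = f"
  using assms
proof (induction rule: Dias_induct)
  case (basis i)
  have "(rotate_dias n ^^ (n + 1)) (cyclic_basis n (int i)) =
      cyclic_basis n (int i - int (n + 1)) - cyclic_basis n (- int (n + 1))"
    by (rule rotate_dias_power)
  also have "cyclic_basis n (int i - int (n + 1)) = cyclic_basis n (int i)"
    by (rule cyclic_basis_cong, rule cong_sym) (simp add: cong_iff_dvd_diff add.commute)
  also have "cyclic_basis n (- int (n + 1)) = cyclic_basis n 0"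
    by (rule cyclic_basis_cong, rule cong_sym) (simp add: cong_iff_dvd_diff add.commute)
  finally show ?case using basis by (simp add: cyclic_basis_of_nat cyclic_basis_0)
qed (simp_all add: rotate_dias_power_linear del: funpow.simps)

lemma rotate_dias_comp:
  assumes f: "f \<in> Dias m" and g: "g \<in> Dias n" and i: "2 \<le> i" "i \<le> m"
  shows "rotate_dias (m + n - 1) (dias_comp f i g) = dias_comp (rotate_dias m f) (i - 1) g"
  using f
proof (induction rule: Dias_induct)
  case a: (basis a)
  from g show ?case
  proof (induction rule: Dias_induct)
    case b: (basis b)
    have "graft_pointer (a - 1) (i - 1) n b = graft_pointer a i n b - 1"
      "graft_pointer m (i - 1) n b = m + n - 1"
      using a b i by (auto simp: graft_pointer_def)
    then show ?case
      using a b i graft_pointer_bounds[of a m b n i]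
      by (simp add: dias_comp_basis rotate_dias_basis dias_comp_diff_left)
  qed (simp_all add: dias_comp_bilinear rotate_dias_add rotate_dias_scale rotate_dias_0)
qed (simp_all add: dias_comp_bilinear rotate_dias_add rotate_dias_scale rotate_dias_0)

lemma rotate_dias_comp_1:
  assumes f: "f \<in> Dias m" and g: "g \<in> Dias n" and "1 \<le> m" "1 \<le> n"
  shows "rotate_dias (m + n - 1) (dias_comp f 1 g) =
    - dias_comp (rotate_dias n g) n (rotate_dias m f)"
  using f
proof (induction rule: Dias_induct)
  case a: (basis a)
  from g show ?case
  proof (induction rule: Dias_induct)
    case b: (basis b)
    have gp: "graft_pointer (b - 1) n m' c = b - 1" "graft_pointer n n m' c = n + c - 1" for m' c
      using b by (auto simp: graft_pointer_def)
    have bd: "1 \<le> graft_pointer a 1 n b" "graft_pointer a 1 n b \<le> m + n - 1"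
      using graft_pointer_bounds[of a m b n 1] a b assms by auto
    have l: "rotate_dias (m + n - 1) (dias_comp (dias_basis m a) 1 (dias_basis n b)) =
        dias_basis (m + n - 1) (graft_pointer a 1 n b - 1) - dias_basis (m + n - 1) (m + n - 1)"
      using a b assms bd by (simp add: dias_comp_basis rotate_dias_basis del: One_nat_def)
    have r: "dias_comp (dias_basis n (b - 1) - dias_basis n n) n (dias_basis m c) =
        dias_basis (m + n - 1) (b - 1) - dias_basis (m + n - 1) (n + c - 1)"
      if "1 \<le> c" "c \<le> m" for c
      using that b assms by (simp add: dias_comp_diff_left dias_comp_basis gp add.commute
          del: One_nat_def)
    \<comment> \<open>For \<open>a = 1\<close> the first summand of the rotation of \<open>e\<^sub>a\<close> is zero, and the rule \<open>r\<close> applies only to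
        the second one; otherwise it applies to both.\<close>
    show ?case
    proof (cases "a = 1")
      case True
      then show ?thesis
        unfolding l using a b assms
        by (simp add: rotate_dias_basis dias_comp_diff_right dias_comp_minus_right r graft_pointer_def add.commute
            del: One_nat_def)
    next
      case False
      then show ?thesis
        unfolding l using a b assms
        by (simp add: rotate_dias_basis dias_comp_diff_right dias_comp_minus_right r graft_pointer_def add.commute
            del: One_nat_def)
    qed
  qed (simp_all add: dias_comp_bilinear rotate_dias_add rotate_dias_scale rotate_dias_0)
qed (simp_all add: dias_comp_bilinear rotate_dias_add rotate_dias_scale rotate_dias_0)

text \<open>The property by which \<open>dias_tau\<close> is chosen.\<close>

definition is_dias_rotation :: "(nat \<Rightarrow> dias \<Rightarrow> dias) \<Rightarrow> bool" where
  "is_dias_rotation \<tau> \<longleftrightarrow>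
     ns_anticyclic_operad dias_scale Dias dias_comp dias_unit \<tau> \<and>
     (\<forall>f\<in>Dias 1. \<tau> 1 f = - f) \<and>
     \<tau> 2 dias_dashv = - dias_vdash \<and>
     \<tau> 2 dias_vdash = dias_dashv - dias_vdash"

lemma is_dias_rotation_rotate_dias: "is_dias_rotation rotate_dias"
  unfolding is_dias_rotation_def
proof (intro conjI ballI)
  have minus: "rotate_dias 1 f = - f" if "f \<in> Dias 1" for f
    using that
    by (induction rule: Dias_induct) (auto simp: rotate_dias_0 rotate_dias_add
        rotate_dias_scale dias.scale_minus_right rotate_dias_basis)
  then show "rotate_dias 1 f = - f" if "f \<in> Dias 1" for f using that .
  show "ns_anticyclic_operad dias_scale Dias dias_comp dias_unit rotate_dias"
  proof (intro ns_anticyclic_operad.intro ns_anticyclic_operad_axioms.intro)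
    show "rotate_dias 1 dias_unit = - dias_unit"
      unfolding dias_unit_eq by (intro minus dias_basis_in) simp
  qed (rule ns_operad_Dias rotate_dias_in rotate_dias_add rotate_dias_scale rotate_dias_order
    rotate_dias_comp rotate_dias_comp_1; assumption)+
qed (simp_all add: dias_dashv_eq dias_vdash_eq rotate_dias_basis)

text \<open>Every basis vector of arity \<open>n + 1\<close> is \<open>x \<circ>\<^sub>1 y\<close>, where \<open>x\<close> is a generator and \<open>y\<close> a basis vector of
  arity \<open>n\<close>. The axiom for composition at the first input expresses its rotation through those of
  \<open>x\<close> and \<open>y\<close>.\<close>

lemma dias_rotation_unique:
  assumes \<sigma>: "is_dias_rotation \<sigma>" and \<tau>: "is_dias_rotation \<tau>" and "1 \<le> n" "f \<in> Dias n"
  shows "\<sigma> n f = \<tau> n f"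
proof -
  interpret S: ns_anticyclic_operad dias_scale Dias dias_comp dias_unit \<sigma>
    using \<sigma> by (simp add: is_dias_rotation_def)
  interpret T: ns_anticyclic_operad dias_scale Dias dias_comp dias_unit \<tau>
    using \<tau> by (simp add: is_dias_rotation_def)
  have basis: "\<forall>i. 1 \<le> i \<and> i \<le> n \<longrightarrow> \<sigma> n (dias_basis n i) = \<tau> n (dias_basis n i)"
    using \<open>1 \<le> n\<close>
  proof (induction n rule: dec_induct)
    case base
    show ?case using \<sigma> \<tau> dias_basis_in[of 1 1] by (auto simp: is_dias_rotation_def)
  next
    case (step n)
    have eq: "\<sigma> (Suc n) (dias_comp (dias_basis 2 j) 1 (dias_basis n i)) =
        \<tau> (Suc n) (dias_comp (dias_basis 2 j) 1 (dias_basis n i))"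
      if "j = 1 \<or> j = 2" "1 \<le> i" "i \<le> n" for i j
    proof -
      have "\<sigma> 2 (dias_basis 2 j) = \<tau> 2 (dias_basis 2 j)"
        using that(1) \<sigma> \<tau> by (auto simp: is_dias_rotation_def dias_dashv_eq dias_vdash_eq)
      moreover have "\<sigma> n (dias_basis n i) = \<tau> n (dias_basis n i)"
        using step.IH that by simp
      moreover have "dias_basis 2 j \<in> Dias 2" "dias_basis n i \<in> Dias n"
        using that by (auto intro!: dias_basis_in)
      ultimately show ?thesis
        using S.tau_comp_1[of "dias_basis 2 j" 2 "dias_basis n i" n]
          T.tau_comp_1[of "dias_basis 2 j" 2 "dias_basis n i" n] step.hyps by simp
    qed
    show ?case
    proof (intro allI impI)
      fix i assume i: "1 \<le> i \<and> i \<le> Suc n"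
      show "\<sigma> (Suc n) (dias_basis (Suc n) i) = \<tau> (Suc n) (dias_basis (Suc n) i)"
      proof (cases "i \<le> n")
        case True
        then have "dias_comp (dias_basis 2 1) 1 (dias_basis n i) = dias_basis (Suc n) i"
          using i by (simp add: dias_comp_basis graft_pointer_def)
        then show ?thesis using eq[of 1 i] i True by simp
      next
        case False
        with i have "i = Suc n" by simp
        then have "dias_comp (dias_basis 2 2) 1 (dias_basis n n) = dias_basis (Suc n) i"
          using step.hyps by (simp add: dias_comp_basis graft_pointer_def)
        then show ?thesis using eq[of 2 n] step.hyps by simp
      qed
    qed
  qed
  have "f \<in> Dias n \<and> \<sigma> n f = \<tau> n f"
    using \<open>f \<in> Dias n\<close>
  proof (induction rule: Dias_induct)
    case zero
    have "\<sigma> n 0 = 0" "\<tau> n 0 = 0"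
      using S.tau_add[of 0 n 0] T.tau_add[of 0 n 0] \<open>1 \<le> n\<close> dias.subspace_0[OF subspace_Dias, of n]
      by auto
    then show ?case using dias.subspace_0[OF subspace_Dias, of n] by simp
  next
    case (add x y)
    then show ?case
      using S.tau_add[of x n y] T.tau_add[of x n y] \<open>1 \<le> n\<close>
      by (auto intro: dias.subspace_add[OF subspace_Dias])
  next
    case (scale c x)
    then show ?case
      using S.tau_scale[of x n c] T.tau_scale[of x n c] \<open>1 \<le> n\<close>
      by (auto intro: dias.subspace_scale[OF subspace_Dias])
  next
    case (basis i)
    then show ?case using basis \<open>\<forall>i. _ \<longrightarrow> _\<close> by (auto intro: dias_basis_in)
  qed
  then show ?thesis by simp
qed

lemma dias_tau_eq: "1 \<le> n \<Longrightarrow> f \<in> Dias n \<Longrightarrow> dias_tau n f = rotate_dias n f"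
proof (rule dias_rotation_unique[OF _ is_dias_rotation_rotate_dias])
  show "is_dias_rotation dias_tau"
    unfolding dias_tau_def is_dias_rotation_def[symmetric]
    using is_dias_rotation_rotate_dias by (rule someI[where P = is_dias_rotation])
qed

lemma dias_tau_power:
  assumes "1 \<le> n" "f \<in> Dias n"
  shows "(dias_tau n ^^ k) f = (rotate_dias n ^^ k) f"
proof -
  have "(rotate_dias n ^^ k) f \<in> Dias n" for k
    using assms(2) rotate_dias_in by (cases k) auto
  then show ?thesis by (induction k) (auto simp: dias_tau_eq[OF assms(1)])
qed

section \<open>The characteristic function of Dias\<close>

lemma cyclic_module_Dias:
  assumes "1 \<le> n"
  shows "cyclic_module dias_scale (n + 1) (Dias n) (dias_tau n) (dias_basis n ` {1..n})"
proof (intro cyclic_module.intro cyclic_module_axioms.intro)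
  have in_Dias: "dias_tau n ` Dias n \<subseteq> Dias n"
    using dias_tau_eq[OF assms] rotate_dias_in by auto
  show "dias_tau n ` Dias n \<subseteq> Dias n" by (fact in_Dias)
  show "linear_on dias_scale dias_scale (Dias n) (dias_tau n)"
    using dias_tau_eq[OF assms] subspace_Dias[of n]
    by (auto simp: linear_on_def rotate_dias_add rotate_dias_scale
        dias.subspace_add dias.subspace_scale)
  show "(dias_tau n ^^ (n + 1)) x = x" if "x \<in> Dias n" for x
    using that dias_tau_power[OF assms that] rotate_dias_order[OF that]
    by (simp del: funpow.simps)
  show "Dias n \<subseteq> dias.span (dias_basis n ` {1..n})"
  proof
    fix x assume x: "x \<in> Dias n"
    have "(\<Sum>i\<in>{1..n}. dias_scale (dias_coeff n i x) (dias_basis n i))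
        \<in> dias.span (dias_basis n ` {1..n})"
      by (intro dias.span_sum dias.span_scale dias.span_base imageI)
    then show "x \<in> dias.span (dias_basis n ` {1..n})"
      by (simp only: dias_expand[OF x])
  qed
qed (use assms subspace_Dias vector_space_dias in auto)

lemma dias_coeff_diff: "dias_coeff n i (x - y) = dias_coeff n i x - dias_coeff n i y"
  using dias_coeff_add[of n i "x - y" y] by simp

lemma dias_coeff_cyclic_basis:
  assumes "1 \<le> i" "i \<le> n"
  shows "dias_coeff n i (cyclic_basis n j) = (if [j = int i] (mod (int n + 1)) then 1 else 0)"
proof -
  define l where "l = nat (j mod (int n + 1))"
  have l: "int l = j mod (int n + 1)" "l \<le> n"
    using pos_mod_bound[of "int n + 1" j] by (auto simp: l_def)
  have "[j = int i] (mod (int n + 1)) \<longleftrightarrow> i = l"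
    unfolding cong_def using l assms by auto
  moreover have "dias_coeff n i 0 = 0"
    using dias_coeff_diff[of n i 0 0] by simp
  ultimately show ?thesis
    using assms l(2) unfolding cyclic_basis_def l_def[symmetric]
    by (cases "l = 0") (auto simp: dias_coeff_basis)
qed

text \<open>The \<open>k\<close>-th power maps \<open>e\<^sub>i\<close> to \<open>e\<^sub>i\<^sub>-\<^sub>k - e\<^sub>-\<^sub>k\<close>, with indices modulo \<open>n + 1\<close>. The first term contributes to the trace
  only for \<open>k = 0\<close>, and the second one only for \<open>k \<noteq> 0\<close>, at \<open>i = n + 1 - k\<close>.\<close>

lemma trace_dias_tau_power:
  assumes "1 \<le> n" "k \<le> n"
  shows "trace_on dias_scale (Dias n) (dias_tau n ^^ k) = (if k = 0 then of_nat (n + 1) else 0) - 1"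
proof -
  interpret C: cyclic_module dias_scale "n + 1" "Dias n" "dias_tau n" "dias_basis n ` {1..n}"
    by (rule cyclic_module_Dias[OF assms(1)])
  have entry: "dias_coeff n i ((dias_tau n ^^ k) (dias_basis n i)) =
      (if k = 0 then 1 else 0) - (if i = n + 1 - k then 1 else 0)" if i: "i \<in> {1..n}" for i
  proof -
    have "(dias_tau n ^^ k) (dias_basis n i) = (rotate_dias n ^^ k) (cyclic_basis n (int i))"
      using i assms dias_basis_in[of i n] by (simp add: dias_tau_power cyclic_basis_of_nat)
    also have "\<dots> = cyclic_basis n (int i - int k) - cyclic_basis n (- int k)"
      by (rule rotate_dias_power)
    finally have pow: "(dias_tau n ^^ k) (dias_basis n i) =
        cyclic_basis n (int i - int k) - cyclic_basis n (- int k)" .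
    have "[int i - int k = int i] (mod (int n + 1)) \<longleftrightarrow> int (n + 1) dvd int k"
      by (simp add: cong_iff_dvd_diff add.commute)
    also have "\<dots> \<longleftrightarrow> k = 0"
      using assms by (auto dest: dvd_imp_le simp del: of_nat_add of_nat_Suc)
    finally have 1: "[int i - int k = int i] (mod (int n + 1)) \<longleftrightarrow> k = 0" .
    have neg: "- int k - int i = - int (i + k)" by simp
    have "[- int k = int i] (mod (int n + 1)) \<longleftrightarrow> int (n + 1) dvd - int (i + k)"
      unfolding cong_iff_dvd_diff neg by (simp only: of_nat_add of_nat_1)
    also have "\<dots> \<longleftrightarrow> n + 1 dvd i + k"
      by (simp only: dvd_minus_iff int_dvd_int_iff)
    also have "\<dots> \<longleftrightarrow> i = n + 1 - k"
    proof
      assume "n + 1 dvd i + k"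
      then obtain q where q: "i + k = (n + 1) * q" by (elim dvdE)
      have "q < 2"
      proof (rule ccontr)
        assume "\<not> q < 2"
        then have "(n + 1) * 2 \<le> (n + 1) * q" by (intro mult_le_mono2) simp
        then show False using q i assms by simp
      qed
      moreover have "q \<noteq> 0" using q i by (cases "q = 0") auto
      ultimately have "q = 1" by simp
      then show "i = n + 1 - k" using q by simp
    qed (use assms in simp)
    finally have 2: "[- int k = int i] (mod (int n + 1)) \<longleftrightarrow> i = n + 1 - k" .
    show ?thesis
      using i by (simp only: pow dias_coeff_diff dias_coeff_cyclic_basis 1 2 atLeastAtMost_iff)
  qed
  have "trace_on dias_scale (Dias n) (dias_tau n ^^ k) =
      (\<Sum>i\<in>{1..n}. dias_coeff n i ((dias_tau n ^^ k) (dias_basis n i)))"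
    by (rule trace_on_frame[OF vector_space_dias subspace_Dias _ _ _ dias_expand C.tk_linear])
       (use C.tk_in in \<open>auto simp: linear_on_def dias_coeff_add dias_coeff_scale dias_basis_in\<close>)
  also have "\<dots> = (\<Sum>i\<in>{1..n}. (if k = 0 then 1 else 0) - (if i = n + 1 - k then 1 else 0))"
    by (intro sum.cong refl entry)
  also have "\<dots> = (if k = 0 then of_nat (n + 1) else 0) - 1"
    using assms by (auto simp: sum_subtractf)
  finally show ?thesis .
qed

text \<open>The number of \<open>k\<close> in \<open>{1..N}\<close> with \<open>gcd k N = N/d\<close> is the totient of \<open>d\<close>.\<close>

lemma sum_gcd_eq_sum_totient:
  fixes f :: "nat \<Rightarrow> 'a::comm_semiring_1"
  assumes "N > 0"
  shows "(\<Sum>k<N. f (N div gcd k N)) = (\<Sum>d | d dvd N. of_nat (totient d) * f d)"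
proof -
  define h where "h k = f (N div gcd k N)" for k
  have "(\<Sum>k<N. h k) = (\<Sum>k\<in>{0<..N}. h k)"
  \<comment> \<open>The index \<open>0\<close> is replaced by \<open>N\<close>, which has the same gcd with \<open>N\<close>.\<close>
  proof (rule sum.reindex_bij_witness
      [where i = "\<lambda>k. if k = N then 0 else k" and j = "\<lambda>k. if k = 0 then N else k"])
  qed (use assms in \<open>auto simp: h_def split: if_splits\<close>)
  also have "\<dots> = (\<Sum>g | g dvd N. \<Sum>k\<in>{k\<in>{0<..N}. gcd k N = g}. h k)"
    by (rule sum.group[symmetric]) (use assms in auto)
  also have "\<dots> = (\<Sum>g | g dvd N. of_nat (totient (N div g)) * f (N div g))"
  proof (rule sum.cong)
    fix g assume "g \<in> {g. g dvd N}"
    then have g: "g dvd N" by simp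
    have "(\<Sum>k\<in>{k\<in>{0<..N}. gcd k N = g}. h k) = (\<Sum>k\<in>{k\<in>{0<..N}. gcd k N = g}. f (N div g))"
      by (rule sum.cong) (auto simp: h_def)
    then show "(\<Sum>k\<in>{k\<in>{0<..N}. gcd k N = g}. h k) = of_nat (totient (N div g)) * f (N div g)"
      using card_gcd_eq_totient[OF assms g] by simp
  qed simp
  also have "\<dots> = (\<Sum>d | d dvd N. of_nat (totient d) * f d)"
    by (rule sum.reindex_bij_witness[where i = "\<lambda>d. N div d" and j = "\<lambda>d. N div d"])
       (use assms in \<open>auto simp: div_div_eq_right\<close>)
  finally show ?thesis by (simp add: h_def)
qed

text \<open>The traces are those of the regular representation (\<open>N\<close> at \<open>k = 0\<close>, else \<open>0\<close>) minus those of the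
  trivial one (always \<open>1\<close>); the two parts give the two terms.\<close>

lemma frobenius_char_Dias:
  assumes "1 \<le> n"
  defines "N \<equiv> n + 1"
  shows "frobenius_char N (induced_scale dias_scale) (induced_space N (Dias n) (dias_tau n))
      induced_action =
    power_sum 1 ^ N -
      const (1 / of_nat N) * (\<Sum>d | d dvd N. of_nat (totient d) * power_sum d ^ (N div d))"
proof -
  interpret C: cyclic_module dias_scale N "Dias n" "dias_tau n" "dias_basis n ` {1..n}"
    unfolding N_def by (rule cyclic_module_Dias[OF assms(1)])
  have N: "N > 0" by (simp add: N_def)
  let ?p = "\<lambda>d. power_sum d ^ (N div d)"
  have ct: "(\<Prod>j\<in>#cycle_type N (C.rot ^^ k). power_sum j) = ?p (N div gcd k N)" for k
    using N by (simp add: cycle_type_long_cycle_funpow div_div_eq_right)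
  have "(\<Sum>k<N. const (C.power_trace k) * (\<Prod>j\<in>#cycle_type N (C.rot ^^ k). power_sum j)) =
      (\<Sum>k<N. (if k = 0 then const (of_nat N) * power_sum 1 ^ N else 0) - ?p (N div gcd k N))"
  proof (rule sum.cong)
    fix k assume "k \<in> {..<N}"
    then have "k \<le> n" by (simp add: N_def)
    have "C.power_trace k = (if k = 0 then of_nat N else 0) - 1"
      unfolding C.power_trace_def N_def by (rule trace_dias_tau_power[OF assms(1) \<open>k \<le> n\<close>])
    then show "const (C.power_trace k) * (\<Prod>j\<in>#cycle_type N (C.rot ^^ k). power_sum j) =
        (if k = 0 then const (of_nat N) * power_sum 1 ^ N else 0) - ?p (N div gcd k N)"
      unfolding ct using N by (simp add: const_diff const_1 const_0 left_diff_distrib)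
  qed simp
  also have "\<dots> = const (of_nat N) * power_sum 1 ^ N - (\<Sum>k<N. ?p (N div gcd k N))"
    using N by (simp add: sum_subtractf)
  also have "(\<Sum>k<N. ?p (N div gcd k N)) = (\<Sum>d | d dvd N. of_nat (totient d) * ?p d)"
    by (rule sum_gcd_eq_sum_totient[OF N])
  finally have "(\<Sum>k<N. const (C.power_trace k) * (\<Prod>j\<in>#cycle_type N (C.rot ^^ k). power_sum j)) =
      const (of_nat N) * power_sum 1 ^ N - (\<Sum>d | d dvd N. of_nat (totient d) * ?p d)" .
  moreover have "const (1 / of_nat N) * (const (of_nat N) * F) = F" for F
    using N by (simp add: mult.assoc[symmetric] const_1 flip: const_mult)
  ultimately show ?thesis
    unfolding C.frobenius_char_induced by (simp only: right_diff_distrib)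
qed

text \<open>An operation of arity \<open>n\<close> contributes in degree \<open>n + 1\<close>.\<close>

lemma formal_sum_shift:
  assumes "\<And>n. 1 \<le> n \<Longrightarrow> F n = G (n + 1)"
  shows "formal_sum {1..} F = formal_sum {2..} G"
proof -
  have "(\<Sum>n | n \<in> {1..} \<and> coeff (F n) M \<noteq> 0. coeff (F n) M) =
      (\<Sum>n | n \<in> {2..} \<and> coeff (G n) M \<noteq> 0. coeff (G n) M)" for M
    by (rule sum.reindex_bij_witness[where i = "\<lambda>n. n - 1" and j = "\<lambda>n. n + 1"])
       (auto simp: assms)
  then show ?thesis by (simp add: formal_sum_def)
qed

theorem theorem6p1:
  shows "char_function_ns dias_scale Dias dias_tau =
    formal_sum {2..} (\<lambda>n. power_sum 1 ^ n -
      const (1 / of_nat n) * (\<Sum>d | d dvd n. of_nat (totient d) * power_sum d ^ (n div d)))"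
  unfolding char_function_ns_def char_function_def
  by (rule formal_sum_shift) (rule frobenius_char_Dias)

end
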